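(* (1) Let $\mathbb{H}_1,\mathbb{H}_2$ be separable Hilbert spaces and let $T:\mathbb{H}_1\to\mathbb{H}_2$ be a linear Hilbert--Schmidt operator. Let $\mathcal{W}_0$ be the class of all distributions $\mathbb{P}^{\Xi}$ of centered Hilbert-space processes $\Xi$ on $\mathbb{H}_2$ with $\|\mathrm{Cov}_{\Xi}\|<\infty$. Then a purely data driven convergent statistical regularization method $(R,\alpha)$ (for $T$) with respect to $\mathcal{W}_0$ exists if and only if the range $\mathcal{R}(T)$ of $T$ is closed. (2) For certain probability distributions $\mathbb{P}^{\Xi}$ there exist purely data driven convergent statistical regularization methods with respect to $\mathcal{W}:=\{\mathbb{P}^{\Xi}\}$ even if the problem is ill-posed. That is, there exist separable Hilbert spaces $\mathbb{H}_1,\mathbb{H}_2$, a linear Hilbert--Schmidt operator $T:\mathbb{H}_1\to\mathbb{H}_2$ whose range is not closed, and the distribution $\mathbb{P}^{\Xi}$ of a centered Hilbert-space process $\Xi$ on $\mathbb{H}_2$ with $\|\mathrm{Cov}_{\Xi}\|\le 1$, such that a purely data driven convergent statistical regularization method $(R,\alpha)$ (for $T$) with respect to $\mathcal{W}=\{\mathbb{P}^{\Xi}\}$ exists.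
   Context: All Hilbert spaces are real. Let $\{(s_j;v_j,u_j)\}_j$ be the singular system of $T$, with $s_j$ in decreasing order, $Tx=\sum_j s_j\langle x,v_j\rangle_{\mathbb{H}_1}u_j$. $T^{+}$ denotes the generalized inverse: the linear extension of $(T|_{\ker(T)^{\perp}})^{-1}$ to $\mathcal{D}(T^{+})=\mathcal{R}(T)+\mathcal{R}(T)^{\perp}$ with kernel $\mathcal{R}(T)^{\perp}$. Linear regularization. A family $F=\{F_\alpha\}_{\alpha>0}$ of bounded functions $F_\alpha:[0,\|T\|^2]\to\mathbb{R}$ is a regularization filter if, with $b_\alpha(\vartheta):=1-\vartheta F_\alpha(\vartheta)$: (i) $\lim_{\alpha\to0}b_\alpha(s_j^2)=0$ for all $s_j>0$; (ii) there are $\alpha_0,\gamma_0>0$ with $\sup_{\alpha\le\alpha_0}\sup_{s_j>0}|b_\alpha(s_j^2)|\le\gamma_0$; (iii) there is $\gamma_*>0$ with $s_j|F_\alpha(s_j^2)|<\gamma_*/\sqrt{\alpha}$ for all $\alpha>0$, $s_j>0$. Throughout, every filter is also assumed to satisfy $\sup_{0<\vartheta\le\|T\|^2}|F_\alpha(\vartheta)|\le\gamma/\alpha$ for all $\alpha>0$ with some constant $\gamma>0$. The associated linear regularization scheme is $R=\{R_\alpha\}_{\alpha>0}$, $R_\alpha y:=F_\alpha(T^*T)T^*y=\sum_{s_j>0}F_\alpha(s_j^2)s_j\langle y,u_j\rangle_{\mathbb{H}_2}v_j$. Noise. A Hilbert-space process is a continuous linear operator $\Xi:\mathbb{H}_2\to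 L^2(\Omega,\mathcal{F},\mathbb{P})$, $v\mapsto\langle\Xi,v\rangle_{\mathbb{H}_2}$, where $(\Omega,\mathcal{F},\mathbb{P})$ is a probability space and $L^2$ consists of real square-integrable random variables. It is centered if $\mathbb{E}\langle\Xi,v\rangle_{\mathbb{H}_2}=0$ for all $v$. Its covariance $\mathrm{Cov}_\Xi:\mathbb{H}_2\to\mathbb{H}_2$ is defined by $\langle\mathrm{Cov}_\Xi y_1,y_2\rangle_{\mathbb{H}_2}=\mathrm{Cov}(\langle\Xi,y_1\rangle_{\mathbb{H}_2},\langle\Xi,y_2\rangle_{\mathbb{H}_2})$. Its distribution $\mathbb{P}^\Xi$ is the probability measure on $(\mathbb{R}^{\mathbb{H}_2},(\mathcal{B}_{\mathbb{R}})^{\otimes\mathbb{H}_2})$ determined by the finite-dimensional marginal distributions. Observations. For $y\in\mathcal{D}(T^+)$ and a class $\mathcal{W}$ of distributions put $\mathbb{M}_{\mathcal{W}}(y):=\{Y_\delta=y+\delta\Xi:\ \delta>0,\ \mathbb{P}^\Xi\in\mathcal{W},\ \|\mathrm{Cov}_\Xi\|\le1\}$. As an argument of a parameter choice, $Y_\delta(\omega)$ is identified with the sequence $\{Y_{\delta,j}(\omega)\}_{s_j>0}$, $Y_{\delta,j}(\omega)=\langle y,u_j\rangle_{\mathbb{H}_2}+\delta\langle\Xi,u_j\rangle_{\mathbb{H}_2}(\omega)$ (regarded as an element of $\mathbb{R}^{\mathbb{N}}$), and $R_\alpha Y_\delta(\omega)=\sum_{s_j>0}F_\alpha(s_j^2)s_jY_{\delta,j}(\omega)v_j$.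 Convergent statistical regularization. For a linear regularization scheme $R$ and a measurable function $\alpha:(0,\infty)\times\mathbb{R}^{\mathbb{N}}\to(0,\infty)$, the pair $(R,\alpha)$ is a convergent statistical regularization (method) w.r.t. $\mathcal{W}$ if for every $y\in\mathcal{D}(T^+)$, every sequence $Y^{(k)}=y+\delta^{(k)}\Xi^{(k)}\in\mathbb{M}_{\mathcal{W}}(y)$, $k\ge1$, with $\lim_{k\to\infty}\delta^{(k)}=0$, and every $\epsilon>0$, $$\lim_{k\to\infty}\mathbb{P}\left(\left\{\omega:\ \left\|T^+y-R_{\alpha(\delta^{(k)},Y^{(k)}(\omega))}Y^{(k)}(\omega)\right\|_{\mathbb{H}_1}>\epsilon\right\}\right)=0 .$$ It is purely data driven if $\alpha$ does not depend on its first argument (the noise level), i.e. $\alpha=\alpha(Y)$. The problem is called ill-posed if $\mathcal{R}(T)$ is not closed. *)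

theory Defs
  imports "HOL-Probability.Probability"
begin

section \<open>The sequence space l2\<close>

text \<open>
  A concrete infinite-dimensional separable real Hilbert space, used as a witness in an existence
  claim about Hilbert spaces (types cannot be existentially quantified).
\<close>

typedef ell2 = "{x :: nat \<Rightarrow> real. summable (\<lambda>i. (x i)\<^sup>2)}"
  morphisms nth_ell2 Abs_ell2
  by (rule exI[of _ "\<lambda>_. 0"]) simp

lemma ell2_eqI: "(\<And>i. nth_ell2 x i = nth_ell2 y i) \<Longrightarrow> x = y"
  by (metis ext nth_ell2_inject)

lemma summable_ell2: "summable (\<lambda>i. (nth_ell2 x i)\<^sup>2)"
  using nth_ell2[of x] by simp

lemma nth_Abs_ell2: "summable (\<lambda>i. (x i)\<^sup>2) \<Longrightarrow> nth_ell2 (Abs_ell2 x) = x"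
  by (simp add: Abs_ell2_inverse)

lemma summable_mult_l2:
  fixes x y :: "nat \<Rightarrow> real"
  assumes "summable (\<lambda>i. (x i)\<^sup>2)" "summable (\<lambda>i. (y i)\<^sup>2)"
  shows "summable (\<lambda>i. x i * y i)"
proof (rule summable_comparison_test')
  show "summable (\<lambda>i. (x i)\<^sup>2 + (y i)\<^sup>2)"
    using assms by (rule summable_add)
  show "norm (x i * y i) \<le> (x i)\<^sup>2 + (y i)\<^sup>2" if "i \<ge> 0" for i
  proof -
    have "2 * (\<bar>x i\<bar> * \<bar>y i\<bar>) \<le> (x i)\<^sup>2 + (y i)\<^sup>2"
      using sum_squares_bound[of "\<bar>x i\<bar>" "\<bar>y i\<bar>"] by (simp add: algebra_simps)
    moreover have "0 \<le> \<bar>x i\<bar> * \<bar>y i\<bar>" by simp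
    ultimately show ?thesis unfolding real_norm_def abs_mult by linarith
  qed
qed

lemma summable_add_l2:
  fixes x y :: "nat \<Rightarrow> real"
  assumes "summable (\<lambda>i. (x i)\<^sup>2)" "summable (\<lambda>i. (y i)\<^sup>2)"
  shows "summable (\<lambda>i. (x i + y i)\<^sup>2)"
proof -
  have "summable (\<lambda>i. ((x i)\<^sup>2 + (y i)\<^sup>2) + 2 * (x i * y i))"
    by (intro summable_add summable_mult assms summable_mult_l2)
  then show ?thesis by (simp add: power2_sum mult.assoc)
qed

lemma summable_scale_l2:
  fixes x :: "nat \<Rightarrow> real"
  assumes "summable (\<lambda>i. (x i)\<^sup>2)"
  shows "summable (\<lambda>i. (r * x i)\<^sup>2)"
  using summable_mult[OF assms, of "r\<^sup>2"] by (simp add: power_mult_distrib)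

instantiation ell2 :: real_vector
begin

definition "0 = Abs_ell2 (\<lambda>_. 0)"
definition "x + y = Abs_ell2 (\<lambda>i. nth_ell2 x i + nth_ell2 y i)"
definition "- x = Abs_ell2 (\<lambda>i. - nth_ell2 x i)"
definition "x - y = Abs_ell2 (\<lambda>i. nth_ell2 x i + - nth_ell2 y i)"
definition "r *\<^sub>R x = Abs_ell2 (\<lambda>i. r * nth_ell2 x i)"

lemma nth_zero_ell2 [simp]: "nth_ell2 0 i = 0"
  by (simp add: zero_ell2_def nth_Abs_ell2)

lemma nth_add_ell2 [simp]: "nth_ell2 (x + y) i = nth_ell2 x i + nth_ell2 y i"
  by (simp add: plus_ell2_def nth_Abs_ell2 summable_add_l2 summable_ell2)

lemma nth_uminus_ell2 [simp]: "nth_ell2 (- x) i = - nth_ell2 x i"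
  by (simp add: uminus_ell2_def nth_Abs_ell2 summable_ell2)

lemma nth_diff_ell2 [simp]: "nth_ell2 (x - y) i = nth_ell2 x i - nth_ell2 y i"
proof -
  have "summable (\<lambda>i. (nth_ell2 x i + - nth_ell2 y i)\<^sup>2)"
    by (rule summable_add_l2) (simp_all add: summable_ell2)
  then show ?thesis by (simp only: minus_ell2_def nth_Abs_ell2 diff_conv_add_uminus)
qed

lemma nth_scaleR_ell2 [simp]: "nth_ell2 (r *\<^sub>R x) i = r * nth_ell2 x i"
  by (simp add: scaleR_ell2_def nth_Abs_ell2 summable_scale_l2 summable_ell2)

instance
proof
qed (rule ell2_eqI, simp add: algebra_simps)+

end

instantiation ell2 :: real_inner
begin

definition inner_ell2 :: "ell2 \<Rightarrow> ell2 \<Rightarrow> real"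
  where "inner_ell2 x y = (\<Sum>i. nth_ell2 x i * nth_ell2 y i)"
definition norm_ell2 :: "ell2 \<Rightarrow> real"
  where "norm_ell2 x = sqrt (inner x x)"
definition sgn_ell2 :: "ell2 \<Rightarrow> ell2"
  where "sgn_ell2 x = x /\<^sub>R norm x"
definition dist_ell2 :: "ell2 \<Rightarrow> ell2 \<Rightarrow> real"
  where "dist_ell2 x y = norm (x - y)"
definition uniformity_ell2 :: "(ell2 \<times> ell2) filter"
  where "uniformity_ell2 = (INF e\<in>{0 <..}. principal {(x, y). dist x y < e})"
definition open_ell2 :: "ell2 set \<Rightarrow> bool"
  where "open_ell2 S = (\<forall>x\<in>S. \<forall>\<^sub>F (x', y) in uniformity. x' = x \<longrightarrow> y \<in> S)"

instance
proof
  fix x y z :: ell2 and r :: real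
  have s: "summable (\<lambda>i. nth_ell2 a i * nth_ell2 b i)" for a b
    by (intro summable_mult_l2 summable_ell2)
  show "inner x y = inner y x"
    by (simp add: inner_ell2_def mult.commute)
  show "inner (x + y) z = inner x z + inner y z"
    by (simp add: inner_ell2_def suminf_add s distrib_right)
  show "inner (r *\<^sub>R x) y = r * inner x y"
    by (simp add: inner_ell2_def suminf_mult s mult.assoc)
  show "0 \<le> inner x x"
    unfolding inner_ell2_def by (rule suminf_nonneg[OF s]) simp
  show "inner x x = 0 \<longleftrightarrow> x = 0"
  proof
    assume "inner x x = 0"
    then have "\<forall>i. nth_ell2 x i * nth_ell2 x i = 0"
      unfolding inner_ell2_def by (subst (asm) suminf_eq_zero_iff[OF s]) auto
    then show "x = 0" by (intro ell2_eqI) simp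
  qed (simp add: inner_ell2_def)
qed (simp_all add: norm_ell2_def sgn_ell2_def dist_ell2_def uniformity_ell2_def open_ell2_def)

end

lemma norm_ell2_power2: "(norm x)\<^sup>2 = (\<Sum>i. (nth_ell2 x i)\<^sup>2)" for x :: ell2
  unfolding power2_norm_eq_inner inner_ell2_def by (simp add: power2_eq_square)

lemma sum_le_norm_ell2: "(\<Sum>i<k. (nth_ell2 x i)\<^sup>2) \<le> (norm x)\<^sup>2" for x :: ell2
  unfolding norm_ell2_power2 by (rule sum_le_suminf) (auto simp: summable_ell2)

lemma abs_nth_le_norm_ell2: "\<bar>nth_ell2 x i\<bar> \<le> norm x" for x :: ell2
proof -
  have "(nth_ell2 x i)\<^sup>2 \<le> (\<Sum>i<Suc i. (nth_ell2 x i)\<^sup>2)"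
    by (simp add: sum_nonneg)
  also have "\<dots> \<le> (norm x)\<^sup>2" by (rule sum_le_norm_ell2)
  finally show ?thesis by (metis abs_le_square_iff abs_norm_cancel)
qed

instance ell2 :: banach
proof
  fix X :: "nat \<Rightarrow> ell2"
  assume X: "Cauchy X"
  have "Cauchy (\<lambda>n. nth_ell2 (X n) i)" for i
  proof (rule metric_CauchyI)
    fix e :: real assume "e > 0"
    then obtain N where N: "\<And>m n. m \<ge> N \<Longrightarrow> n \<ge> N \<Longrightarrow> dist (X m) (X n) < e"
      using X unfolding Cauchy_def by blast
    have "dist (nth_ell2 (X m) i) (nth_ell2 (X n) i) < e" if "m \<ge> N" "n \<ge> N" for m n
      using N[OF that] abs_nth_le_norm_ell2[of "X m - X n" i] by (simp add: dist_norm)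
    then show "\<exists>N. \<forall>m\<ge>N. \<forall>n\<ge>N. dist (nth_ell2 (X m) i) (nth_ell2 (X n) i) < e" by blast
  qed
  then have "\<exists>l. (\<lambda>n. nth_ell2 (X n) i) \<longlonglongrightarrow> l" for i
    by (simp add: Cauchy_convergent_iff convergent_def)
  then obtain l where l: "\<And>i. (\<lambda>n. nth_ell2 (X n) i) \<longlonglongrightarrow> l i" by metis
  have bound: "\<exists>N. \<forall>m\<ge>N. \<forall>k. (\<Sum>i<k. (nth_ell2 (X m) i - l i)\<^sup>2) \<le> e\<^sup>2" if "e > 0" for e :: real
  proof -
    obtain N where N: "\<And>m n. m \<ge> N \<Longrightarrow> n \<ge> N \<Longrightarrow> dist (X m) (X n) < e"
      using X \<open>e > 0\<close> unfolding Cauchy_def by blast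
    have "(\<Sum>i<k. (nth_ell2 (X m) i - l i)\<^sup>2) \<le> e\<^sup>2" if m: "m \<ge> N" for m k
    proof (rule tendsto_upperbound)
      show "(\<lambda>n. \<Sum>i<k. (nth_ell2 (X m) i - nth_ell2 (X n) i)\<^sup>2)
          \<longlonglongrightarrow> (\<Sum>i<k. (nth_ell2 (X m) i - l i)\<^sup>2)"
        by (intro tendsto_intros l)
      show "\<forall>\<^sub>F n in sequentially. (\<Sum>i<k. (nth_ell2 (X m) i - nth_ell2 (X n) i)\<^sup>2) \<le> e\<^sup>2"
        unfolding eventually_sequentially
      proof (intro exI allI impI)
        fix n assume n: "N \<le> n"
        have "norm (X m - X n) \<le> e"
          using N[OF m n] by (simp add: dist_norm)
        then have "(norm (X m - X n))\<^sup>2 \<le> e\<^sup>2"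
          by (intro power_mono) auto
        then show "(\<Sum>i<k. (nth_ell2 (X m) i - nth_ell2 (X n) i)\<^sup>2) \<le> e\<^sup>2"
          using sum_le_norm_ell2[where x = "X m - X n" and k = k] by simp
      qed
    qed simp
    then show ?thesis by blast
  qed
  have diff: "summable (\<lambda>i. (nth_ell2 (X m) i - l i)\<^sup>2)"
    if "\<forall>k. (\<Sum>i<k. (nth_ell2 (X m) i - l i)\<^sup>2) \<le> c" for m c
    using that by (intro summableI_nonneg_bounded[of _ c]) auto
  obtain N1 where N1: "\<forall>k. (\<Sum>i<k. (nth_ell2 (X N1) i - l i)\<^sup>2) \<le> 1\<^sup>2"
    using bound[of 1] by auto
  have "summable (\<lambda>i. (nth_ell2 (X N1) i + (-1) * (nth_ell2 (X N1) i - l i))\<^sup>2)"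
    by (intro summable_add_l2 summable_scale_l2 summable_ell2 diff[OF N1])
  then have l2: "summable (\<lambda>i. (l i)\<^sup>2)" by simp
  define L where "L = Abs_ell2 l"
  have L: "nth_ell2 L = l" by (simp add: L_def nth_Abs_ell2 l2)
  have "X \<longlonglongrightarrow> L"
  proof (rule metric_LIMSEQ_I)
    fix r :: real assume "r > 0"
    then obtain N where N: "\<forall>m\<ge>N. \<forall>k. (\<Sum>i<k. (nth_ell2 (X m) i - l i)\<^sup>2) \<le> (r/2)\<^sup>2"
      using bound[of "r/2"] by auto
    have "dist (X m) L < r" if "m \<ge> N" for m
    proof -
      have "(norm (X m - L))\<^sup>2 \<le> (r/2)\<^sup>2"
        unfolding norm_ell2_power2 using N that
        by (intro suminf_le_const summable_ell2) (auto simp: L)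
      then have "norm (X m - L) \<le> r/2"
        using \<open>r > 0\<close> by (simp add: power2_le_iff_abs_le)
      then show ?thesis using \<open>r > 0\<close> by (simp add: dist_norm)
    qed
    then show "\<exists>no. \<forall>n\<ge>no. dist (X n) L < r" by blast
  qed
  then show "convergent X" by (rule convergentI)
qed

lemma dense_ell2:
  fixes x :: ell2
  assumes "e > 0"
  shows "\<exists>qs :: rat list. dist (Abs_ell2 (\<lambda>i. if i < length qs then of_rat (qs ! i) else 0)) x < e"
proof -
  obtain N where N: "\<bar>\<Sum>i. (nth_ell2 x (i + N))\<^sup>2\<bar> < e\<^sup>2 / 2"
    using suminf_exist_split[OF _ summable_ell2[of x], of "e\<^sup>2/2"] assms by auto
  define c where "c = sqrt (e\<^sup>2 / (2 * (real N + 1)))"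
  have c: "c > 0" using assms by (simp add: c_def)
  have "\<exists>q :: rat. \<bar>of_rat q - nth_ell2 x i\<bar> < c" for i
  proof -
    obtain q where "nth_ell2 x i - c < of_rat q" "of_rat q < nth_ell2 x i + c"
      using of_rat_dense[of "nth_ell2 x i - c" "nth_ell2 x i + c"] c by auto
    then show ?thesis by (intro exI[of _ q]) linarith
  qed
  then obtain q :: "nat \<Rightarrow> rat" where q: "\<And>i. \<bar>of_rat (q i) - nth_ell2 x i\<bar> < c" by metis
  define qs where "qs = map q [0..<N]"
  let ?f = "\<lambda>i. if i < length qs then of_rat (qs ! i) else 0 :: real"
  have "summable (\<lambda>i. (?f i)\<^sup>2)"
    by (rule summable_finite[of "{..<N}"]) (auto simp: qs_def)
  then have f: "nth_ell2 (Abs_ell2 ?f) = ?f" by (rule nth_Abs_ell2)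
  define A where "A = Abs_ell2 ?f"
  have A: "nth_ell2 A i = (if i < N then of_rat (q i) else 0)" for i
    by (simp add: A_def f) (simp add: qs_def)
  let ?d = "\<lambda>i. (nth_ell2 (A - x) i)\<^sup>2"
  have "(norm (A - x))\<^sup>2 = (\<Sum>i. ?d (i + N)) + (\<Sum>i<N. ?d i)"
    unfolding norm_ell2_power2 by (rule suminf_split_initial_segment[OF summable_ell2])
  also have "(\<Sum>i. ?d (i + N)) = (\<Sum>i. (nth_ell2 x (i + N))\<^sup>2)"
    by (simp add: A)
  also have "(\<Sum>i<N. ?d i) \<le> (\<Sum>i<N. c\<^sup>2)"
  proof (rule sum_mono)
    fix i assume "i \<in> {..<N}"
    then have "?d i = \<bar>of_rat (q i) - nth_ell2 x i\<bar>\<^sup>2" by (simp add: A)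
    also have "\<dots> \<le> c\<^sup>2" using q[of i] by (intro power_mono) auto
    finally show "?d i \<le> c\<^sup>2" .
  qed
  also have "(\<Sum>i<N. c\<^sup>2) \<le> e\<^sup>2 / 2"
    using assms by (simp add: c_def field_simps)
  finally have "(norm (A - x))\<^sup>2 < e\<^sup>2" using N by linarith
  then have "norm (A - x) < e"
    by (rule power2_less_imp_less) (use assms in simp)
  then have "dist (Abs_ell2 ?f) x < e" by (simp only: dist_norm A_def)
  then show ?thesis by (rule exI[of _ qs])
qed

instance ell2 :: second_countable_topology
proof
  define d :: "rat list \<Rightarrow> ell2"
    where "d qs = Abs_ell2 (\<lambda>i. if i < length qs then of_rat (qs ! i) else 0)" for qs
  define B where "B = (\<lambda>(qs, n::nat). ball (d qs) (1 / real (Suc n))) ` UNIV"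
  have "topological_basis B"
  proof (rule topological_basisI)
    show "open S" if "S \<in> B" for S using that by (auto simp: B_def)
    fix U and x :: ell2 assume "open U" "x \<in> U"
    then obtain e where e: "e > 0" "ball x e \<subseteq> U" by (meson open_contains_ball)
    obtain n where n: "1 / real (Suc n) < e / 2"
      using nat_approx_posE[of "e/2"] e(1) by auto
    obtain qs where qs: "dist (d qs) x < 1 / real (Suc n)"
      unfolding d_def using dense_ell2[of "1 / real (Suc n)" x] by auto
    have "ball (d qs) (1 / real (Suc n)) \<subseteq> ball x e"
    proof
      fix z assume "z \<in> ball (d qs) (1 / real (Suc n))"
      then show "z \<in> ball x e"
        using qs n dist_triangle[of x z "d qs"] by (simp add: dist_commute)
    qed
    then show "\<exists>S\<in>B. x \<in> S \<and> S \<subseteq> U"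
      using qs e(2) by (intro bexI[of _ "ball (d qs) (1 / real (Suc n))"])
        (auto simp: B_def intro!: image_eqI[of _ _ "(qs, n)"])
  qed
  moreover have "countable B" by (simp add: B_def)
  ultimately show "\<exists>B::ell2 set set. countable B \<and> open = generate_topology B"
    using topological_basis_imp_subbasis by blast
qed


section \<open>Operators and the generalized inverse\<close>

text \<open>
  A separable real Hilbert space is a type of class \<open>{real_inner, banach, second_countable_topology}\<close>.
\<close>

definition orthonormal_basis :: "'a::real_inner set \<Rightarrow> bool" where
  "orthonormal_basis B \<longleftrightarrow>
     pairwise orthogonal B \<and> (\<forall>e\<in>B. norm e = 1) \<and> closure (span B) = UNIV"

definition hilbert_schmidt :: "('a::real_inner \<Rightarrow> 'b::real_inner) \<Rightarrow> bool" where
  "hilbert_schmidt T \<longleftrightarrow>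
     bounded_linear T \<and> (\<exists>B. orthonormal_basis B \<and> (\<lambda>e. (norm (T e))\<^sup>2) summable_on B)"

text \<open>
  The system is indexed by \<open>\<nat>\<close>. If \<open>T\<close> has finite rank, then \<open>s j = 0\<close> from some index on, and
  \<open>v j\<close>, \<open>u j\<close> are irrelevant there; only the triples with \<open>s j > 0\<close> carry information.
\<close>

definition singular_system ::
  "('a::real_inner \<Rightarrow> 'b::real_inner) \<Rightarrow> (nat \<Rightarrow> real) \<Rightarrow> (nat \<Rightarrow> 'a) \<Rightarrow> (nat \<Rightarrow> 'b) \<Rightarrow> bool" where
  "singular_system T s v u \<longleftrightarrow>
     decseq s \<and> (\<forall>j. s j \<ge> 0) \<and>
     (\<forall>i j. s i > 0 \<and> s j > 0 \<longrightarrow>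
        v i \<bullet> v j = (if i = j then 1 else 0) \<and> u i \<bullet> u j = (if i = j then 1 else 0)) \<and>
     (\<forall>x. (\<lambda>j. (s j * (x \<bullet> v j)) *\<^sub>R u j) sums T x)"

definition ginv_domain :: "('a::real_inner \<Rightarrow> 'b::real_inner) \<Rightarrow> 'b set" where
  "ginv_domain T = {y + z | y z. y \<in> range T \<and> z \<in> orthogonal_comp (range T)}"

text \<open>
  \<open>T\<^sup>+ (T x + z) = x\<close> for \<open>x \<in> ker(T)\<^sup>\<bottom>\<close> and \<open>z \<in> R(T)\<^sup>\<bottom>\<close>; outside \<open>ginv_domain T\<close> the value is
  unspecified.
\<close>

definition ginv :: "('a::real_inner \<Rightarrow> 'b::real_inner) \<Rightarrow> 'b \<Rightarrow> 'a" where
  "ginv T y = (THE x. x \<in> orthogonal_comp {x. T x = 0} \<and> y - T x \<in> orthogonal_comp (range T))"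

lemma ginv_eq:
  assumes T: "bounded_linear T"
    and x: "x \<in> orthogonal_comp {x. T x = 0}" and z: "z \<in> orthogonal_comp (range T)"
  shows "ginv T (T x + z) = x"
  unfolding ginv_def
proof (rule the_equality)
  interpret bounded_linear T by (rule T)
  show "x \<in> orthogonal_comp {x. T x = 0} \<and> T x + z - T x \<in> orthogonal_comp (range T)"
    using x z by simp
  fix x' assume x': "x' \<in> orthogonal_comp {x. T x = 0} \<and> T x + z - T x' \<in> orthogonal_comp (range T)"
  have "(T x + z - T x') - z \<in> orthogonal_comp (range T)"
    using x' z subspace_diff[OF subspace_orthogonal_comp] by metis
  then have "T (x - x') \<in> orthogonal_comp (range T)" by (simp add: diff)
  then have "T (x - x') \<bullet> T (x - x') = 0"
    unfolding orthogonal_comp_def orthogonal_def by blast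
  then have "T (x - x') = 0" by simp
  moreover have "x - x' \<in> orthogonal_comp {x. T x = 0}"
    using x x' subspace_diff[OF subspace_orthogonal_comp] by metis
  ultimately have "(x - x') \<bullet> (x - x') = 0"
    unfolding orthogonal_comp_def orthogonal_def by blast
  then show "x' = x" by simp
qed


section \<open>Linear regularization\<close>

definition regularization_filter ::
  "('a::real_normed_vector \<Rightarrow> 'b::real_normed_vector) \<Rightarrow> (nat \<Rightarrow> real) \<Rightarrow> (real \<Rightarrow> real \<Rightarrow> real) \<Rightarrow> bool"
where
  "regularization_filter T s F \<longleftrightarrow>
     (let b = (\<lambda>\<alpha> \<theta>. 1 - \<theta> * F \<alpha> \<theta>) in
       (\<forall>\<alpha>>0. bounded (F \<alpha> ` {0..(onorm T)\<^sup>2})) \<and>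
       (\<forall>j. s j > 0 \<longrightarrow> ((\<lambda>\<alpha>. b \<alpha> ((s j)\<^sup>2)) \<longlongrightarrow> 0) (at_right 0)) \<and>
       (\<exists>\<alpha>\<^sub>0>0. \<exists>\<gamma>\<^sub>0>0. \<forall>\<alpha> j. 0 < \<alpha> \<and> \<alpha> \<le> \<alpha>\<^sub>0 \<and> s j > 0 \<longrightarrow> \<bar>b \<alpha> ((s j)\<^sup>2)\<bar> \<le> \<gamma>\<^sub>0) \<and>
       (\<exists>\<gamma>>0. \<forall>\<alpha> j. \<alpha> > 0 \<and> s j > 0 \<longrightarrow> s j * \<bar>F \<alpha> ((s j)\<^sup>2)\<bar> < \<gamma> / sqrt \<alpha>) \<and>
       (\<exists>\<gamma>>0. \<forall>\<alpha> \<theta>. \<alpha> > 0 \<and> 0 < \<theta> \<and> \<theta> \<le> (onorm T)\<^sup>2 \<longrightarrow> \<bar>F \<alpha> \<theta>\<bar> \<le> \<gamma> / \<alpha>))"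

text \<open>
  \<open>R\<^sub>\<alpha>\<close> acting on a data sequence \<open>Y j = \<langle>y, u j\<rangle>\<close>; the terms with \<open>s j = 0\<close> vanish.
\<close>

definition regularize ::
  "(real \<Rightarrow> real \<Rightarrow> real) \<Rightarrow> (nat \<Rightarrow> real) \<Rightarrow> (nat \<Rightarrow> 'a::real_normed_vector) \<Rightarrow> real \<Rightarrow> (nat \<Rightarrow> real) \<Rightarrow> 'a"
where
  "regularize F s v \<alpha> Y = (\<Sum>j. (F \<alpha> ((s j)\<^sup>2) * s j * Y j) *\<^sub>R v j)"


section \<open>Hilbert-space processes\<close>

text \<open>
  \<open>\<Xi> v\<close> is a representative of the class \<open>\<langle>\<Xi>, v\<rangle> \<in> L\<^sup>2\<close>, so linearity holds almost everywhere for each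
  fixed linear combination; the last conjunct is boundedness as a map into \<open>L\<^sup>2\<close>.
\<close>

definition hilbert_process :: "'w measure \<Rightarrow> ('b::real_normed_vector \<Rightarrow> 'w \<Rightarrow> real) \<Rightarrow> bool" where
  "hilbert_process M \<Xi> \<longleftrightarrow>
     prob_space M \<and>
     (\<forall>v. \<Xi> v \<in> borel_measurable M \<and> integrable M (\<lambda>\<omega>. (\<Xi> v \<omega>)\<^sup>2)) \<and>
     (\<forall>a b v w. AE \<omega> in M. \<Xi> (a *\<^sub>R v + b *\<^sub>R w) \<omega> = a * \<Xi> v \<omega> + b * \<Xi> w \<omega>) \<and>
     (\<exists>K. \<forall>v. sqrt (\<integral>\<omega>. (\<Xi> v \<omega>)\<^sup>2 \<partial>M) \<le> norm v * K)"

definition centered :: "'w measure \<Rightarrow> ('b \<Rightarrow> 'w \<Rightarrow> real) \<Rightarrow> bool" where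
  "centered M \<Xi> \<longleftrightarrow> (\<forall>v. (\<integral>\<omega>. \<Xi> v \<omega> \<partial>M) = 0)"

text \<open>
  At most one operator \<open>C\<close> satisfies this, and boundedness of \<open>C\<close> expresses \<open>\<parallel>Cov\<^sub>\<Xi>\<parallel> < \<infinity>\<close>.
\<close>

definition is_covariance :: "'w measure \<Rightarrow> ('b::real_inner \<Rightarrow> 'w \<Rightarrow> real) \<Rightarrow> ('b \<Rightarrow> 'b) \<Rightarrow> bool" where
  "is_covariance M \<Xi> C \<longleftrightarrow>
     bounded_linear C \<and>
     (\<forall>y\<^sub>1 y\<^sub>2. C y\<^sub>1 \<bullet> y\<^sub>2 =
        (\<integral>\<omega>. (\<Xi> y\<^sub>1 \<omega> - (\<integral>\<eta>. \<Xi> y\<^sub>1 \<eta> \<partial>M)) * (\<Xi> y\<^sub>2 \<omega> - (\<integral>\<eta>. \<Xi> y\<^sub>2 \<eta> \<partial>M)) \<partial>M))"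

definition process_law :: "'w measure \<Rightarrow> ('b \<Rightarrow> 'w \<Rightarrow> real) \<Rightarrow> ('b \<Rightarrow> real) measure" where
  "process_law M \<Xi> = distr M (Pi\<^sub>M UNIV (\<lambda>_. borel)) (\<lambda>\<omega> v. \<Xi> v \<omega>)"

text \<open>
  The sample space ranges over all measures on the path space; by \<open>process_law_in_centered_laws\<close>
  below, processes on any other sample space yield no further laws.
\<close>

definition centered_laws :: "('b::real_inner \<Rightarrow> real) measure set" where
  "centered_laws =
     {process_law M \<Xi> | (M :: ('b \<Rightarrow> real) measure) \<Xi>.
        hilbert_process M \<Xi> \<and> centered M \<Xi> \<and> (\<exists>C. is_covariance M \<Xi> C)}"


section \<open>Convergent statistical regularization\<close>

definition parameter_choice :: "(real \<Rightarrow> (nat \<Rightarrow> real) \<Rightarrow> real) \<Rightarrow> bool" where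
  "parameter_choice \<alpha> \<longleftrightarrow>
     case_prod \<alpha> \<in> restrict_space borel {0<..} \<Otimes>\<^sub>M Pi\<^sub>M UNIV (\<lambda>_. borel)
       \<rightarrow>\<^sub>M restrict_space borel {0<..}"

definition purely_data_driven :: "(real \<Rightarrow> (nat \<Rightarrow> real) \<Rightarrow> real) \<Rightarrow> bool" where
  "purely_data_driven \<alpha> \<longleftrightarrow> (\<forall>\<delta>>0. \<forall>\<delta>'>0. \<forall>Y. \<alpha> \<delta> Y = \<alpha> \<delta>' Y)"

text \<open>The family \<open>{Y\<^sub>j}\<close>, \<open>s\<^sub>j > 0\<close>, becomes an element of \<open>\<real>\<^sup>\<nat>\<close> by padding with zeros.\<close>

definition observation ::
  "(nat \<Rightarrow> real) \<Rightarrow> (nat \<Rightarrow> 'b::real_inner) \<Rightarrow> 'b \<Rightarrow> real \<Rightarrow> ('b \<Rightarrow> 'w \<Rightarrow> real) \<Rightarrow> 'w \<Rightarrow> nat \<Rightarrow> real" where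
  "observation s u y \<delta> \<Xi> \<omega> j = (if s j > 0 then y \<bullet> u j + \<delta> * \<Xi> (u j) \<omega> else 0)"

definition admissible_noise ::
  "('b::real_inner \<Rightarrow> real) measure set \<Rightarrow> 'w measure \<Rightarrow> ('b \<Rightarrow> 'w \<Rightarrow> real) \<Rightarrow> bool" where
  "admissible_noise W M \<Xi> \<longleftrightarrow>
     hilbert_process M \<Xi> \<and> process_law M \<Xi> \<in> W \<and> (\<exists>C. is_covariance M \<Xi> C \<and> onorm C \<le> 1)"

definition error_event ::
  "('a::real_inner \<Rightarrow> 'b::real_inner) \<Rightarrow> (nat \<Rightarrow> real) \<Rightarrow> (nat \<Rightarrow> 'a) \<Rightarrow> (nat \<Rightarrow> 'b) \<Rightarrow>
   (real \<Rightarrow> real \<Rightarrow> real) \<Rightarrow> (real \<Rightarrow> (nat \<Rightarrow> real) \<Rightarrow> real) \<Rightarrow>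
   'b \<Rightarrow> real \<Rightarrow> 'w measure \<Rightarrow> ('b \<Rightarrow> 'w \<Rightarrow> real) \<Rightarrow> real \<Rightarrow> 'w set" where
  "error_event T s v u F \<alpha> y \<delta> M \<Xi> \<epsilon> =
     {\<omega> \<in> space M. norm (ginv T y -
        (let Y = observation s u y \<delta> \<Xi> \<omega> in regularize F s v (\<alpha> \<delta> Y) Y)) > \<epsilon>}"

text \<open>
  The pair \<open>(R, \<alpha>)\<close> is given by the filter \<open>F\<close> generating \<open>R\<close> and by \<open>\<alpha>\<close>. Every member of a sequence of
  observations may have its own sample space \<open>M k\<close>; the first argument only fixes the type on which
  these live. Speaking of the probability of the error events presupposes their measurability, which is
  therefore part of the definition (\<^const>\<open>measure\<close> is 0 on non-measurable sets).
\<close>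

definition convergent_statistical_regularization ::
  "'w itself \<Rightarrow> ('a::real_inner \<Rightarrow> 'b::real_inner) \<Rightarrow> (nat \<Rightarrow> real) \<Rightarrow> (nat \<Rightarrow> 'a) \<Rightarrow> (nat \<Rightarrow> 'b) \<Rightarrow>
   (real \<Rightarrow> real \<Rightarrow> real) \<Rightarrow> (real \<Rightarrow> (nat \<Rightarrow> real) \<Rightarrow> real) \<Rightarrow> ('b \<Rightarrow> real) measure set \<Rightarrow> bool" where
  "convergent_statistical_regularization (_ :: 'w itself) T s v u F \<alpha> W \<longleftrightarrow>
     regularization_filter T s F \<and> parameter_choice \<alpha> \<and>
     (\<forall>y \<in> ginv_domain T. \<forall>\<delta> (M :: nat \<Rightarrow> 'w measure) \<Xi>.
        (\<forall>k. \<delta> k > 0 \<and> admissible_noise W (M k) (\<Xi> k)) \<and> \<delta> \<longlonglongrightarrow> 0 \<longrightarrow>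
        (\<forall>\<epsilon>>0. (\<forall>k. error_event T s v u F \<alpha> y (\<delta> k) (M k) (\<Xi> k) \<epsilon> \<in> sets (M k)) \<and>
           (\<lambda>k. measure (M k) (error_event T s v u F \<alpha> y (\<delta> k) (M k) (\<Xi> k) \<epsilon>)) \<longlonglongrightarrow> 0))"

definition data_driven_method_exists ::
  "('a::real_inner \<Rightarrow> 'b::real_inner) \<Rightarrow> (nat \<Rightarrow> real) \<Rightarrow> (nat \<Rightarrow> 'a) \<Rightarrow> (nat \<Rightarrow> 'b) \<Rightarrow>
   ('b \<Rightarrow> real) measure set \<Rightarrow> bool" where
  "data_driven_method_exists T s v u W \<longleftrightarrow>
     (\<exists>F \<alpha>. purely_data_driven \<alpha> \<and>
        convergent_statistical_regularization TYPE('b \<Rightarrow> real) T s v u F \<alpha> W)"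


section \<open>The path space is a sufficient sample space\<close>

text \<open>
  Taking path-space-typed sample spaces loses no generality: the coordinate process under
  \<^term>\<open>process_law M \<Xi>\<close> has all relevant properties of \<open>\<Xi>\<close>.
\<close>

lemma path_measurable:
  assumes "hilbert_process M \<Xi>"
  shows "(\<lambda>\<omega> v. \<Xi> v \<omega>) \<in> M \<rightarrow>\<^sub>M Pi\<^sub>M UNIV (\<lambda>_. borel)"
  using assms by (intro measurable_PiM_single') (auto simp: hilbert_process_def space_PiM PiE_UNIV_domain)

lemma coordinate_measurable: "(\<lambda>p. p v) \<in> borel_measurable (Pi\<^sub>M UNIV (\<lambda>_. borel :: real measure))"
  by (rule measurable_component_singleton) simp

lemma integral_process_law:
  fixes f :: "('b::real_normed_vector \<Rightarrow> real) \<Rightarrow> real"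
  assumes "hilbert_process M \<Xi>" "f \<in> borel_measurable (Pi\<^sub>M UNIV (\<lambda>_. borel))"
  shows "(\<integral>p. f p \<partial>process_law M \<Xi>) = (\<integral>\<omega>. f (\<lambda>v. \<Xi> v \<omega>) \<partial>M)"
  unfolding process_law_def using path_measurable[OF assms(1)] assms(2) by (rule integral_distr)

lemma hilbert_process_coordinate:
  assumes "hilbert_process M \<Xi>"
  shows "hilbert_process (process_law M \<Xi>) (\<lambda>v p. p v)"
  unfolding hilbert_process_def
proof (intro conjI allI)
  note [measurable] = path_measurable[OF assms] coordinate_measurable
  interpret prob_space M using assms by (simp add: hilbert_process_def)
  show "prob_space (process_law M \<Xi>)"
    unfolding process_law_def by (rule prob_space_distr) measurable
  fix v
  show "(\<lambda>p. p v) \<in> borel_measurable (process_law M \<Xi>)"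
    by (simp add: process_law_def)
  show "integrable (process_law M \<Xi>) (\<lambda>p. (p v)\<^sup>2)"
    using assms unfolding process_law_def hilbert_process_def
    by (subst integrable_distr_eq) auto
next
  note [measurable] = path_measurable[OF assms] coordinate_measurable
  fix a b :: real and v w
  have "AE \<omega> in M. \<Xi> (a *\<^sub>R v + b *\<^sub>R w) \<omega> = a * \<Xi> v \<omega> + b * \<Xi> w \<omega>"
    using assms by (simp add: hilbert_process_def)
  then show "AE p in process_law M \<Xi>. p (a *\<^sub>R v + b *\<^sub>R w) = a * p v + b * p w"
    unfolding process_law_def by (subst AE_distr_iff) auto
next
  have "(\<integral>p. (p v)\<^sup>2 \<partial>process_law M \<Xi>) = (\<integral>\<omega>. (\<Xi> v \<omega>)\<^sup>2 \<partial>M)" for v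
    by (rule integral_process_law[OF assms]) (intro borel_measurable_power coordinate_measurable)
  then show "\<exists>K. \<forall>v. sqrt (\<integral>p. (p v)\<^sup>2 \<partial>process_law M \<Xi>) \<le> norm v * K"
    using assms by (simp add: hilbert_process_def)
qed

lemma is_covariance_coordinate:
  assumes "hilbert_process M \<Xi>" "is_covariance M \<Xi> C"
  shows "is_covariance (process_law M \<Xi>) (\<lambda>v p. p v) C"
proof -
  have "(\<integral>p. p v \<partial>process_law M \<Xi>) = (\<integral>\<omega>. \<Xi> v \<omega> \<partial>M)" for v
    by (rule integral_process_law[OF assms(1) coordinate_measurable])
  moreover have "(\<integral>p. (p v - c) * (p w - d) \<partial>process_law M \<Xi>)
      = (\<integral>\<omega>. (\<Xi> v \<omega> - c) * (\<Xi> w \<omega> - d) \<partial>M)" for v w and c d :: real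
    by (rule integral_process_law[OF assms(1)])
      (intro borel_measurable_times borel_measurable_diff coordinate_measurable borel_measurable_const)
  ultimately show ?thesis using assms(2) by (simp add: is_covariance_def)
qed

lemma process_law_coordinate:
  "process_law (process_law M \<Xi>) (\<lambda>v p. p v) = process_law M \<Xi>"
  by (simp add: process_law_def distr_id2)

lemma process_law_in_centered_laws:
  assumes "hilbert_process M \<Xi>" "centered M \<Xi>" "is_covariance M \<Xi> C"
  shows "process_law M \<Xi> \<in> centered_laws"
proof -
  have "centered (process_law M \<Xi>) (\<lambda>v p. p v)"
    using assms(2) integral_process_law[OF assms(1) coordinate_measurable] by (simp add: centered_def)
  then show ?thesis
    unfolding centered_laws_def mem_Collect_eq
    by (intro exI[of _ "process_law M \<Xi>"] exI[of _ "\<lambda>v p. p v"])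
      (auto simp: process_law_coordinate intro: assms hilbert_process_coordinate is_covariance_coordinate)
qed

lemma convergent_statistical_regularization_any_sample_space:
  fixes T :: "'a::real_inner \<Rightarrow> 'b::real_inner"
  assumes conv: "convergent_statistical_regularization TYPE('b \<Rightarrow> real) T s v u F \<alpha> W"
  shows "convergent_statistical_regularization TYPE('w) T s v u F \<alpha> W"
  unfolding convergent_statistical_regularization_def
proof (intro conjI ballI allI impI)
  show "regularization_filter T s F" "parameter_choice \<alpha>"
    using conv by (auto simp: convergent_statistical_regularization_def)
  fix y and \<delta> :: "nat \<Rightarrow> real" and M :: "nat \<Rightarrow> 'w measure" and \<Xi> :: "nat \<Rightarrow> 'b \<Rightarrow> 'w \<Rightarrow> real"
    and \<epsilon> :: real
  assume y: "y \<in> ginv_domain T" and \<epsilon>: "\<epsilon> > 0"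
    and h: "(\<forall>k. \<delta> k > 0 \<and> admissible_noise W (M k) (\<Xi> k)) \<and> \<delta> \<longlonglongrightarrow> 0"
  define L where "L k = process_law (M k) (\<Xi> k)" for k
  let ?X = "\<lambda>v (p :: 'b \<Rightarrow> real). p v"
  let ?E = "\<lambda>k. error_event T s v u F \<alpha> y (\<delta> k) (M k) (\<Xi> k) \<epsilon>"
  let ?E' = "\<lambda>k. error_event T s v u F \<alpha> y (\<delta> k) (L k) ?X \<epsilon>"
  have hp: "hilbert_process (M k) (\<Xi> k)" for k
    using h by (simp add: admissible_noise_def)
  have adm: "admissible_noise W (L k) ?X" for k
    using h hilbert_process_coordinate[OF hp] is_covariance_coordinate[OF hp]
    unfolding admissible_noise_def L_def process_law_coordinate by metis
  have meas: "(\<lambda>\<omega> v. \<Xi> k v \<omega>) \<in> M k \<rightarrow>\<^sub>M Pi\<^sub>M UNIV (\<lambda>_. borel)" for k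
    by (rule path_measurable[OF hp])
  have "(\<forall>k. ?E' k \<in> sets (L k)) \<and> (\<lambda>k. measure (L k) (?E' k)) \<longlonglongrightarrow> 0"
    using conv y \<epsilon> h adm unfolding convergent_statistical_regularization_def
    by (auto dest!: bspec[OF _ y] spec[of _ \<delta>] spec[of _ L] spec[of _ "\<lambda>_. ?X"])
  then have E': "\<And>k. ?E' k \<in> sets (L k)" and lim: "(\<lambda>k. measure (L k) (?E' k)) \<longlonglongrightarrow> 0"
    by auto
  have E: "?E k = (\<lambda>\<omega> v. \<Xi> k v \<omega>) -` ?E' k \<inter> space (M k)" for k
    by (auto simp: error_event_def observation_def[abs_def] L_def process_law_def space_PiM)
  have sets_E': "?E' k \<in> sets (Pi\<^sub>M UNIV (\<lambda>_. borel))" for k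
    using E'[of k] by (simp add: L_def process_law_def)
  show "?E k \<in> sets (M k)" for k
    unfolding E by (rule measurable_sets[OF meas sets_E'])
  have "measure (L k) (?E' k) = measure (M k) (?E k)" for k
    unfolding E using measure_distr[OF meas sets_E'] by (simp add: L_def process_law_def)
  then show "(\<lambda>k. measure (M k) (?E k)) \<longlonglongrightarrow> 0"
    using lim by simp
qed

end

theory Submission
  imports Defs
begin

text \<open>
  A method without access to the noise level cannot tell a noisy observation of one \<open>y\<close> from an exact
  observation of another. The noise \<open>\<plusminus>w\<close>, a fixed vector with a random sign, makes this precise. For
  \<open>w = 0\<close> the data are exact at every noise level, so the method must reconstruct \<open>T\<^sup>+ y\<close> from the exact data
  of every \<open>y \<in> D(T\<^sup>+)\<close> (\<open>data_driven_method_exact_on_exact_data\<close>). For \<open>w = u\<^sub>k\<close> and noise level \<open>s\<^sub>k\<close> an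
  observation of \<open>y = 0\<close> coincides, with probability 1/2, with the exact data of \<open>s\<^sub>k u\<^sub>k = T v\<^sub>k\<close>; the method
  answers \<open>v\<^sub>k\<close> where it should answer 0. If infinitely many \<open>s\<^sub>k\<close> are positive, they tend to 0 because \<open>T\<close> is
  Hilbert--Schmidt, and this contradicts convergence (\<open>finite_rank_of_data_driven_method\<close>). In short, a purely
  data driven method would make \<open>T\<^sup>+\<close> sequentially continuous. For Hilbert--Schmidt operators a closed range is
  the same as a finite rank (\<open>closed_range_iff_finite_rank\<close>), and for finite rank \<open>T\<^sup>+\<close> itself, written as
  a spectral cutoff with constant parameter, is a method (\<open>data_driven_method_of_finite_rank\<close>).

  A single noise law is a different matter, since it may leave a fingerprint of \<open>\<delta>\<close> in the data. For the
  diagonal operator with \<open>s\<^sub>j = 4\<^sup>-\<^sup>j\<close> every exact observation decays at least like \<open>4\<^sup>-\<^sup>j\<close>, whereas the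
  noise \<open>\<plusminus>w\<close> with \<open>w\<^sub>j = 2\<^sup>-\<^sup>j\<^sup>-\<^sup>1\<close> decays more slowly. Hence \<open>\<bar>Y\<^sub>j\<bar> / w\<^sub>j\<close> tends to \<open>\<delta>\<close>
  (\<open>estimated_noise_level_exact\<close>): the data sequence determines \<open>\<delta>\<close> exactly, and spectral cutoff at
  \<open>\<alpha> = \<delta>\<close> converges (\<open>cutoff_at_noise_level_converges\<close>).
\<close>

section \<open>Orthonormal families\<close>

lemma norm_diff_sum_orthonormal:
  fixes e :: "'i \<Rightarrow> 'a::real_inner"
  assumes "finite J" and on: "\<And>i j. i \<in> J \<Longrightarrow> j \<in> J \<Longrightarrow> e i \<bullet> e j = (if i = j then 1 else 0)"
  shows "(norm (x - (\<Sum>j\<in>J. a j *\<^sub>R e j)))\<^sup>2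
           = (norm x)\<^sup>2 - (\<Sum>j\<in>J. (x \<bullet> e j)\<^sup>2) + (\<Sum>j\<in>J. (a j - x \<bullet> e j)\<^sup>2)"
proof -
  let ?p = "\<Sum>j\<in>J. a j *\<^sub>R e j"
  have "?p \<bullet> ?p = (\<Sum>i\<in>J. \<Sum>j\<in>J. if j = i then a i * a i else 0)"
    by (auto simp: inner_sum_left inner_sum_right on sum_distrib_left intro!: sum.cong)
  then have pp: "?p \<bullet> ?p = (\<Sum>j\<in>J. a j * a j)"
    using \<open>finite J\<close> by simp
  have xp: "x \<bullet> ?p = (\<Sum>j\<in>J. a j * (x \<bullet> e j))"
    by (simp add: inner_sum_right)
  have "(norm (x - ?p))\<^sup>2 = (norm x)\<^sup>2 - 2 * (x \<bullet> ?p) + ?p \<bullet> ?p"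
    by (simp only: power2_norm_eq_inner inner_diff_left inner_diff_right inner_commute[of ?p x])
  also have "\<dots> = (norm x)\<^sup>2 - (\<Sum>j\<in>J. (x \<bullet> e j)\<^sup>2) + (\<Sum>j\<in>J. (a j - x \<bullet> e j)\<^sup>2)"
    unfolding pp xp
    by (simp add: power2_eq_square algebra_simps sum.distrib sum_subtractf sum_distrib_left)
  finally show ?thesis .
qed

lemma Bessel_inequality:
  fixes e :: "'i \<Rightarrow> 'a::real_inner"
  assumes "finite J" "\<And>i j. i \<in> J \<Longrightarrow> j \<in> J \<Longrightarrow> e i \<bullet> e j = (if i = j then 1 else 0)"
  shows "(\<Sum>j\<in>J. (x \<bullet> e j)\<^sup>2) \<le> (norm x)\<^sup>2"
proof -
  have "0 \<le> (norm (x - (\<Sum>j\<in>J. (x \<bullet> e j) *\<^sub>R e j)))\<^sup>2" by simp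
  also have "\<dots> = (norm x)\<^sup>2 - (\<Sum>j\<in>J. (x \<bullet> e j)\<^sup>2)"
    by (subst norm_diff_sum_orthonormal[OF assms]) auto
  finally show ?thesis by simp
qed

lemma norm_sum_orthonormal:
  fixes e :: "'i \<Rightarrow> 'a::real_inner"
  assumes "finite J" "\<And>i j. i \<in> J \<Longrightarrow> j \<in> J \<Longrightarrow> e i \<bullet> e j = (if i = j then 1 else 0)"
  shows "(norm (\<Sum>j\<in>J. a j *\<^sub>R e j))\<^sup>2 = (\<Sum>j\<in>J. (a j)\<^sup>2)"
  using norm_diff_sum_orthonormal[OF assms, where x = 0] by simp

text \<open>
  Half of Parseval's identity, up to a constant: the best approximation of \<open>x\<close> from the span of the
  finite set \<open>F\<close> is at least as good as some given element of that span close to \<open>x\<close>.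
\<close>

lemma orthonormal_basis_captures_half:
  assumes "orthonormal_basis B" "norm x = 1"
  obtains F where "finite F" "F \<subseteq> B" "1/2 \<le> (\<Sum>e\<in>F. (x \<bullet> e)\<^sup>2)"
proof -
  have "x \<in> closure (span B)" using assms by (simp add: orthonormal_basis_def)
  then obtain p where p: "p \<in> span B" "dist p x < 1/2"
    unfolding closure_approachable by (meson half_gt_zero zero_less_one)
  then obtain F r where F: "finite F" "F \<subseteq> B" and pF: "p = (\<Sum>e\<in>F. r e *\<^sub>R e)"
    unfolding span_explicit by auto
  have on: "e \<bullet> f = (if e = f then 1 else 0)" if "e \<in> F" "f \<in> F" for e f
    using assms(1) that subsetD[OF F(2)] unfolding orthonormal_basis_def pairwise_def orthogonal_def
    by (metis norm_eq_1)
  have "1 - (\<Sum>e\<in>F. (x \<bullet> e)\<^sup>2) \<le> 1 - (\<Sum>e\<in>F. (x \<bullet> e)\<^sup>2) + (\<Sum>e\<in>F. (r e - x \<bullet> e)\<^sup>2)"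
    by (simp add: sum_nonneg)
  also have "\<dots> = (norm (x - p))\<^sup>2"
    using norm_diff_sum_orthonormal[OF F(1), of "\<lambda>e. e", OF on, of x r] assms(2) by (simp add: pF)
  also have "\<dots> \<le> (1/2)\<^sup>2"
    using p(2) by (intro power_mono) (auto simp: dist_norm norm_minus_commute)
  finally show ?thesis using that F by (simp add: power2_eq_square)
qed


section \<open>Singular systems\<close>

lemma singular_system_orthonormal:
  assumes "singular_system T s v u" "s i > 0" "s j > 0"
  shows "v i \<bullet> v j = (if i = j then 1 else 0)" "u i \<bullet> u j = (if i = j then 1 else 0)"
  using assms by (simp_all add: singular_system_def)

lemma singular_system_sums:
  assumes "singular_system T s v u"
  shows "(\<lambda>j. (s j * (x \<bullet> v j)) *\<^sub>R u j) sums T x"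
  using assms by (simp add: singular_system_def)

lemma singular_value_pos_or_zero:
  assumes "singular_system T s v u"
  shows "s j > 0 \<or> s j = 0"
  using assms by (auto simp: singular_system_def order_le_less)

lemma inner_image_left_singular_vector:
  assumes S: "singular_system T s v u" and j: "s j > 0"
  shows "T x \<bullet> u j = s j * (x \<bullet> v j)"
proof -
  have "(\<lambda>i. ((s i * (x \<bullet> v i)) *\<^sub>R u i) \<bullet> u j) sums (T x \<bullet> u j)"
    by (rule bounded_linear.sums[OF bounded_linear_inner_left singular_system_sums[OF S]])
  moreover have "((s i * (x \<bullet> v i)) *\<^sub>R u i) \<bullet> u j = (if i = j then s i * (x \<bullet> v i) else 0)" for i
    using singular_value_pos_or_zero[OF S, of i] singular_system_orthonormal(2)[OF S _ j, of i] by auto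
  ultimately show ?thesis
    using sums_unique2[OF _ sums_single] by fastforce
qed

lemma image_right_singular_vector:
  assumes S: "singular_system T s v u" and j: "s j > 0"
  shows "T (v j) = s j *\<^sub>R u j"
proof -
  have "(s i * (v j \<bullet> v i)) *\<^sub>R u i = (if i = j then s i *\<^sub>R u i else 0)" for i
    using singular_value_pos_or_zero[OF S, of i] singular_system_orthonormal(1)[OF S j, of i] by auto
  then show ?thesis
    using singular_system_sums[OF S, of "v j"] sums_unique2[OF _ sums_single] by fastforce
qed

lemma left_singular_vector_in_range:
  assumes "bounded_linear T" "singular_system T s v u" "s j > 0"
  shows "u j \<in> range T"
proof -
  interpret bounded_linear T by fact
  have "T (v j /\<^sub>R s j) = u j"
    using assms by (simp add: scaleR image_right_singular_vector)
  then show ?thesis by (metis rangeI)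
qed

lemma right_singular_vector_in_kernel_complement:
  assumes S: "singular_system T s v u" and j: "s j > 0"
  shows "v j \<in> orthogonal_comp {x. T x = 0}"
proof -
  have "x \<bullet> v j = 0" if "T x = 0" for x
    using inner_image_left_singular_vector[OF S j, of x] that j by simp
  then show ?thesis by (simp add: orthogonal_comp_def orthogonal_def)
qed

lemma ginv_left_singular_vector:
  assumes "bounded_linear T" "singular_system T s v u" "s j > 0"
  shows "ginv T (s j *\<^sub>R u j) = v j"
  using ginv_eq[OF assms(1) right_singular_vector_in_kernel_complement[OF assms(2,3)], of 0]
    image_right_singular_vector[OF assms(2,3)]
  by (simp add: orthogonal_comp_def orthogonal_def)

text \<open>
  \<open>\<parallel>T e\<parallel>\<^sup>2 \<ge> \<Sum>\<^sub>j s\<^sub>j\<^sup>2 \<langle>e, v\<^sub>j\<rangle>\<^sup>2\<close> by Bessel's inequality. Summing over a finite part of the basis that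
  captures half of the norm of each of finitely many \<open>v\<^sub>j\<close> gives \<open>\<Sum>\<^sub>j s\<^sub>j\<^sup>2 \<le> 2 \<Sum>\<^sub>e \<parallel>T e\<parallel>\<^sup>2\<close>; the factor 2
  is harmless for summability.
\<close>

lemma hilbert_schmidt_summable_singular_values:
  assumes H: "hilbert_schmidt T" and S: "singular_system T s v u"
  shows "summable (\<lambda>j. (s j)\<^sup>2)"
proof -
  obtain B where B: "orthonormal_basis B" and sB: "(\<lambda>e. (norm (T e))\<^sup>2) summable_on B"
    using H by (auto simp: hilbert_schmidt_def)
  define K where "K = infsum (\<lambda>e. (norm (T e))\<^sup>2) B"
  have "(\<Sum>j<n. (s j)\<^sup>2) \<le> 2 * K" for n
  proof -
    define J where "J = {j. j < n \<and> s j > 0}"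
    have J: "finite J" "\<And>j. j \<in> J \<Longrightarrow> s j > 0" by (auto simp: J_def)
    have "\<forall>j\<in>J. \<exists>F. finite F \<and> F \<subseteq> B \<and> 1/2 \<le> (\<Sum>e\<in>F. (v j \<bullet> e)\<^sup>2)"
    proof
      fix j assume "j \<in> J"
      then have "norm (v j) = 1"
        using J singular_system_orthonormal(1)[OF S] by (simp add: norm_eq_1)
      then show "\<exists>F. finite F \<and> F \<subseteq> B \<and> 1/2 \<le> (\<Sum>e\<in>F. (v j \<bullet> e)\<^sup>2)"
        using orthonormal_basis_captures_half[OF B] by metis
    qed
    then obtain F where F: "\<And>j. j \<in> J \<Longrightarrow> finite (F j) \<and> F j \<subseteq> B \<and> 1/2 \<le> (\<Sum>e\<in>F j. (v j \<bullet> e)\<^sup>2)"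
      by metis
    define G where "G = (\<Union>j\<in>J. F j)"
    have G: "finite G" "G \<subseteq> B" using F J by (auto simp: G_def)
    have half: "1/2 \<le> (\<Sum>e\<in>G. (e \<bullet> v j)\<^sup>2)" if "j \<in> J" for j
    proof -
      have "(\<Sum>e\<in>F j. (e \<bullet> v j)\<^sup>2) \<le> (\<Sum>e\<in>G. (e \<bullet> v j)\<^sup>2)"
        using that G by (intro sum_mono2) (auto simp: G_def)
      then show ?thesis using F[OF that] by (simp add: inner_commute)
    qed
    have "(\<Sum>j<n. (s j)\<^sup>2) = (\<Sum>j\<in>J. (s j)\<^sup>2)"
      using singular_value_pos_or_zero[OF S] by (intro sum.mono_neutral_right) (auto simp: J_def)
    also have "\<dots> = (\<Sum>j\<in>J. 2 * ((s j)\<^sup>2 * (1/2)))" by simp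
    also have "\<dots> \<le> (\<Sum>j\<in>J. 2 * ((s j)\<^sup>2 * (\<Sum>e\<in>G. (e \<bullet> v j)\<^sup>2)))"
      using half by (intro sum_mono mult_left_mono) auto
    also have "\<dots> = 2 * (\<Sum>e\<in>G. \<Sum>j\<in>J. (T e \<bullet> u j)\<^sup>2)"
      by (subst sum.swap) (simp add: sum_distrib_left inner_image_left_singular_vector[OF S] J
          power_mult_distrib)
    also have "\<dots> \<le> 2 * (\<Sum>e\<in>G. (norm (T e))\<^sup>2)"
      using J singular_system_orthonormal(2)[OF S]
      by (intro mult_left_mono sum_mono Bessel_inequality) auto
    also have "\<dots> \<le> 2 * K"
      unfolding K_def using finite_sum_le_infsum[OF sB G] by simp
    finally show ?thesis .
  qed
  then show ?thesis by (intro summableI_nonneg_bounded[of _ "2 * K"]) auto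
qed

lemma singular_values_all_pos_or_finite:
  assumes "singular_system T s v u"
  shows "(\<forall>j. s j > 0) \<or> finite {j. s j > 0}"
proof (cases "\<forall>j. s j > 0")
  case False
  then obtain k where "s k \<le> 0" by (auto simp: not_less)
  moreover have "s j \<le> s k" if "k \<le> j" for j
    using assms that by (simp add: singular_system_def decseq_def)
  ultimately have "{j. s j > 0} \<subseteq> {..<k}"
    by (force simp: not_less[symmetric])
  then show ?thesis using finite_subset by auto
qed simp

text \<open>
  If all \<open>s\<^sub>j\<close> are positive, then \<open>\<Sum>\<^sub>j s\<^sub>j u\<^sub>j\<close> exists by summability of \<open>s\<^sub>j\<^sup>2\<close> and is a limit of points
  \<open>T (v\<^sub>0 + \<dots> + v\<^sub>n)\<close> of the range, but a preimage would have all its coefficients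
  \<open>\<langle>x, v\<^sub>j\<rangle>\<close> equal to 1. If only finitely many are positive, the range is the fixed space of
  the continuous map \<open>y \<mapsto> \<Sum>\<^sub>j \<langle>y, u\<^sub>j\<rangle> u\<^sub>j\<close>.
\<close>

lemma closed_range_iff_finite_rank:
  fixes T :: "'a::real_inner \<Rightarrow> 'b::{real_inner,banach}"
  assumes H: "hilbert_schmidt T" and S: "singular_system T s v u"
  shows "closed (range T) \<longleftrightarrow> finite {j. s j > 0}"
proof
  have bl: "bounded_linear T" using H by (simp add: hilbert_schmidt_def)
  interpret bounded_linear T by (rule bl)
  assume cl: "closed (range T)"
  show "finite {j. s j > 0}"
  proof (rule ccontr)
    assume "infinite {j. s j > 0}"
    then have pos: "\<And>j. s j > 0" using singular_values_all_pos_or_finite[OF S] by auto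
    note on = singular_system_orthonormal[OF S pos pos]
    have sq: "summable (\<lambda>j. (s j)\<^sup>2)" by (rule hilbert_schmidt_summable_singular_values[OF H S])
    have "summable (\<lambda>j. s j *\<^sub>R u j)"
      unfolding summable_Cauchy
    proof (intro allI impI)
      fix e :: real assume "e > 0"
      then obtain N where N: "\<And>m n. m \<ge> N \<Longrightarrow> norm (\<Sum>j=m..<n. (s j)\<^sup>2) < e\<^sup>2"
        using sq unfolding summable_Cauchy by (metis zero_less_power)
      have "norm (\<Sum>j=m..<n. s j *\<^sub>R u j) < e" if "m \<ge> N" for m n
      proof (rule power2_less_imp_less)
        show "(norm (\<Sum>j=m..<n. s j *\<^sub>R u j))\<^sup>2 < e\<^sup>2"
          using N[OF that, of n] by (subst norm_sum_orthonormal) (auto simp: on)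
      qed (use \<open>e > 0\<close> in simp)
      then show "\<exists>N. \<forall>m\<ge>N. \<forall>n. norm (\<Sum>j=m..<n. s j *\<^sub>R u j) < e" by blast
    qed
    then obtain y where y: "(\<lambda>j. s j *\<^sub>R u j) sums y" by (auto simp: summable_def)
    have "(\<Sum>j<n. s j *\<^sub>R u j) = T (\<Sum>j<n. v j)" for n
      by (simp add: sum image_right_singular_vector[OF S pos])
    then have "(\<Sum>j<n. s j *\<^sub>R u j) \<in> range T" for n by (metis rangeI)
    then have "y \<in> range T"
      using y unfolding sums_def by (rule closed_sequentially[OF cl])
    then obtain x where x: "y = T x" by auto
    have "x \<bullet> v k = 1" for k
    proof -
      have "(\<lambda>j. (s j *\<^sub>R u j) \<bullet> u k) sums (y \<bullet> u k)"
        by (rule bounded_linear.sums[OF bounded_linear_inner_left y])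
      moreover have "(s j *\<^sub>R u j) \<bullet> u k = (if j = k then s j else 0)" for j
        by (simp add: on)
      ultimately have "y \<bullet> u k = s k" using sums_unique2[OF _ sums_single] by fastforce
      then show ?thesis
        using inner_image_left_singular_vector[OF S pos, of x k] pos[of k] x by simp
    qed
    then have "real n \<le> (norm x)\<^sup>2" for n
      using Bessel_inequality[of "{..<n}" v x] on by simp
    then show False using reals_Archimedean2[of "(norm x)\<^sup>2"] by (meson not_less)
  qed
next
  have bl: "bounded_linear T" using H by (simp add: hilbert_schmidt_def)
  interpret bounded_linear T by (rule bl)
  define J where "J = {j. s j > 0}"
  assume "finite {j. s j > 0}"
  then have J: "finite J" by (simp add: J_def)
  have "range T = {y. (\<Sum>j\<in>J. (y \<bullet> u j) *\<^sub>R u j) = y}"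
  proof (intro subset_antisym subsetI)
    fix y assume "y \<in> range T"
    then obtain x where x: "y = T x" by auto
    have "(\<lambda>j. (s j * (x \<bullet> v j)) *\<^sub>R u j) sums (\<Sum>j\<in>J. (s j * (x \<bullet> v j)) *\<^sub>R u j)"
      using singular_value_pos_or_zero[OF S] by (intro sums_finite J) (auto simp: J_def)
    then have "T x = (\<Sum>j\<in>J. (s j * (x \<bullet> v j)) *\<^sub>R u j)"
      using singular_system_sums[OF S] sums_unique2 by blast
    also have "\<dots> = (\<Sum>j\<in>J. (y \<bullet> u j) *\<^sub>R u j)"
      by (simp add: x inner_image_left_singular_vector[OF S] J_def)
    finally show "y \<in> {y. (\<Sum>j\<in>J. (y \<bullet> u j) *\<^sub>R u j) = y}" by (simp add: x)
  next
    fix y assume "y \<in> {y. (\<Sum>j\<in>J. (y \<bullet> u j) *\<^sub>R u j) = y}"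
    then have y: "y = (\<Sum>j\<in>J. (y \<bullet> u j) *\<^sub>R u j)" by simp
    have "(\<Sum>j\<in>J. (y \<bullet> u j) *\<^sub>R u j) \<in> range T"
      using left_singular_vector_in_range[OF bl S] linear_subspace_image[OF linear_axioms subspace_UNIV]
      by (intro subspace_sum subspace_scale) (auto simp: J_def)
    then show "y \<in> range T" using y by simp
  qed
  then show "closed (range T)"
    by (simp add: closed_Collect_eq continuous_intros)
qed


section \<open>Spectral cutoff\<close>

definition spectral_cutoff :: "real \<Rightarrow> real \<Rightarrow> real" where
  "spectral_cutoff \<alpha> \<theta> = (if \<alpha> \<le> \<theta> then 1 / \<theta> else 0)"

lemma spectral_cutoff_bound:
  assumes "\<alpha> > 0"
  shows "\<bar>spectral_cutoff \<alpha> \<theta>\<bar> \<le> 1 / \<alpha>"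
  using assms by (auto simp: spectral_cutoff_def abs_if intro!: divide_left_mono)

lemma spectral_cutoff_residual_bound: "\<bar>1 - \<theta> * spectral_cutoff \<alpha> \<theta>\<bar> \<le> 1"
  by (simp add: spectral_cutoff_def)

lemma mult_spectral_cutoff_square:
  assumes "\<sigma> > 0"
  shows "spectral_cutoff \<alpha> (\<sigma>\<^sup>2) * \<sigma> = (if \<alpha> \<le> \<sigma>\<^sup>2 then 1 / \<sigma> else 0)"
  using assms by (simp add: spectral_cutoff_def power2_eq_square)

lemma inverse_le_inverse_sqrt:
  fixes \<alpha> \<sigma> :: real
  assumes "\<alpha> > 0" "\<sigma> > 0" "\<alpha> \<le> \<sigma>\<^sup>2"
  shows "1 / \<sigma> \<le> 1 / sqrt \<alpha>"
  using assms by (intro divide_left_mono) (auto simp: real_le_lsqrt)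

lemma spectral_cutoff_filter: "regularization_filter T s spectral_cutoff"
  unfolding regularization_filter_def Let_def
proof (intro conjI allI impI)
  show "bounded (spectral_cutoff \<alpha> ` {0..(onorm T)\<^sup>2})" if "\<alpha> > 0" for \<alpha>
    using spectral_cutoff_bound[OF that] unfolding bounded_iff by auto
  show "((\<lambda>\<alpha>. 1 - (s j)\<^sup>2 * spectral_cutoff \<alpha> ((s j)\<^sup>2)) \<longlongrightarrow> 0) (at_right 0)" if "s j > 0" for j
  proof (rule tendsto_eventually)
    show "\<forall>\<^sub>F \<alpha> in at_right 0. 1 - (s j)\<^sup>2 * spectral_cutoff \<alpha> ((s j)\<^sup>2) = 0"
      unfolding eventually_at_right_field
      using that by (intro exI[of _ "(s j)\<^sup>2"]) (auto simp: spectral_cutoff_def)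
  qed
  show "\<exists>\<alpha>\<^sub>0>0. \<exists>\<gamma>\<^sub>0>0. \<forall>\<alpha> j. 0 < \<alpha> \<and> \<alpha> \<le> \<alpha>\<^sub>0 \<and> 0 < s j \<longrightarrow>
          \<bar>1 - (s j)\<^sup>2 * spectral_cutoff \<alpha> ((s j)\<^sup>2)\<bar> \<le> \<gamma>\<^sub>0"
    by (intro exI[of _ 1] conjI allI impI spectral_cutoff_residual_bound) auto
  have "s j * \<bar>spectral_cutoff \<alpha> ((s j)\<^sup>2)\<bar> < 2 / sqrt \<alpha>" if "\<alpha> > 0" "s j > 0" for \<alpha> j
  proof -
    have "s j * \<bar>spectral_cutoff \<alpha> ((s j)\<^sup>2)\<bar> = \<bar>spectral_cutoff \<alpha> ((s j)\<^sup>2) * s j\<bar>"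
      using that by (simp add: abs_mult)
    also have "\<dots> \<le> 1 / sqrt \<alpha>"
      using that inverse_le_inverse_sqrt[of \<alpha> "s j"] by (auto simp: mult_spectral_cutoff_square)
    also have "\<dots> < 2 / sqrt \<alpha>"
      using that by (simp add: divide_strict_right_mono)
    finally show ?thesis .
  qed
  then show "\<exists>\<gamma>>0. \<forall>\<alpha> j. 0 < \<alpha> \<and> 0 < s j \<longrightarrow> s j * \<bar>spectral_cutoff \<alpha> ((s j)\<^sup>2)\<bar> < \<gamma> / sqrt \<alpha>"
    by (intro exI[of _ 2]) auto
  show "\<exists>\<gamma>>0. \<forall>\<alpha> \<theta>. 0 < \<alpha> \<and> 0 < \<theta> \<and> \<theta> \<le> (onorm T)\<^sup>2 \<longrightarrow> \<bar>spectral_cutoff \<alpha> \<theta>\<bar> \<le> \<gamma> / \<alpha>"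
    using spectral_cutoff_bound by (intro exI[of _ 1]) auto
qed

lemma measurable_regularize_spectral_cutoff:
  fixes v :: "nat \<Rightarrow> 'a::{banach,second_countable_topology}"
  assumes [measurable]: "A \<in> borel_measurable M" "\<And>j. (\<lambda>\<omega>. Y \<omega> j) \<in> borel_measurable M"
  shows "(\<lambda>\<omega>. regularize spectral_cutoff s v (A \<omega>) (Y \<omega>)) \<in> borel_measurable M"
  unfolding regularize_def spectral_cutoff_def by measurable

lemma measurable_observation:
  assumes "hilbert_process M \<Xi>"
  shows "(\<lambda>\<omega>. observation s u y \<delta> \<Xi> \<omega> j) \<in> borel_measurable M"
proof -
  have [measurable]: "\<Xi> w \<in> borel_measurable M" for w
    using assms by (simp add: hilbert_process_def)
  show ?thesis unfolding observation_def by measurable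
qed

lemma error_event_spectral_cutoff_measurable:
  fixes T :: "'a::{real_inner,banach,second_countable_topology} \<Rightarrow> 'b::real_inner"
  assumes "hilbert_process M \<Xi>"
    and [measurable]: "\<alpha> \<delta> \<in> borel_measurable (Pi\<^sub>M UNIV (\<lambda>_. borel))"
  shows "error_event T s v u spectral_cutoff \<alpha> y \<delta> M \<Xi> \<epsilon> \<in> sets M"
proof -
  note Y = measurable_observation[OF assms(1), of s u y \<delta>]
  have "(\<lambda>\<omega>. observation s u y \<delta> \<Xi> \<omega>) \<in> M \<rightarrow>\<^sub>M Pi\<^sub>M UNIV (\<lambda>_. borel)"
    using Y by (intro measurable_PiM_single') (auto simp: space_PiM)
  then have "(\<lambda>\<omega>. \<alpha> \<delta> (observation s u y \<delta> \<Xi> \<omega>)) \<in> borel_measurable M"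
    by measurable
  note [measurable] = measurable_regularize_spectral_cutoff[OF this Y, of s v]
  show ?thesis unfolding error_event_def Let_def by measurable
qed


section \<open>Noise of random sign in a fixed direction\<close>

text \<open>
  Convergence on the path space carries over to every sample space, so two points are enough for a random
  sign; every event is measurable here.
\<close>

definition coin :: "bool measure" where
  "coin = measure_pmf (bernoulli_pmf (1/2))"

definition signed_noise :: "'b::real_inner \<Rightarrow> 'b \<Rightarrow> bool \<Rightarrow> real" where
  "signed_noise w v \<omega> = (if \<omega> then w \<bullet> v else - (w \<bullet> v))"

lemma integral_coin: "(\<integral>\<omega>. f \<omega> \<partial>coin) = (f True + f False) / (2::real)"
  by (simp add: coin_def)

lemma hilbert_process_signed_noise: "hilbert_process coin (signed_noise w)"
  unfolding hilbert_process_def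
proof (intro conjI allI)
  show "prob_space coin" by (simp add: coin_def prob_space_measure_pmf)
  show "signed_noise w v \<in> borel_measurable coin" for v by (simp add: coin_def)
  show "integrable coin (\<lambda>\<omega>. (signed_noise w v \<omega>)\<^sup>2)" for v
    unfolding coin_def by (rule integrable_measure_pmf_finite) simp
  show "AE \<omega> in coin. signed_noise w (a *\<^sub>R v + b *\<^sub>R v') \<omega>
          = a * signed_noise w v \<omega> + b * signed_noise w v' \<omega>" for a b v v'
    by (auto simp: signed_noise_def inner_add_right algebra_simps)
  have "sqrt (\<integral>\<omega>. (signed_noise w v \<omega>)\<^sup>2 \<partial>coin) \<le> norm v * norm w" for v
    using Cauchy_Schwarz_ineq2[of w v] by (simp add: integral_coin signed_noise_def mult.commute)
  then show "\<exists>K. \<forall>v. sqrt (\<integral>\<omega>. (signed_noise w v \<omega>)\<^sup>2 \<partial>coin) \<le> norm v * K" by blast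
qed

lemma centered_signed_noise: "centered coin (signed_noise w)"
  by (simp add: centered_def integral_coin signed_noise_def)

lemma is_covariance_signed_noise: "is_covariance coin (signed_noise w) (\<lambda>v. (w \<bullet> v) *\<^sub>R w)"
  unfolding is_covariance_def
proof (intro conjI allI)
  show "bounded_linear (\<lambda>v. (w \<bullet> v) *\<^sub>R w)"
    by (intro bounded_linear_scaleR_const bounded_linear_inner_right)
qed (simp add: integral_coin signed_noise_def)

lemma onorm_covariance_signed_noise:
  assumes "norm w \<le> 1"
  shows "onorm (\<lambda>v. (w \<bullet> v) *\<^sub>R w) \<le> 1"
proof (rule onorm_bound)
  fix v
  have "norm ((w \<bullet> v) *\<^sub>R w) \<le> (norm w * norm v) * norm w"
    using Cauchy_Schwarz_ineq2[of w v] by (simp add: mult_right_mono)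
  also have "\<dots> \<le> (1 * norm v) * 1"
    using assms by (intro mult_mono) auto
  finally show "norm ((w \<bullet> v) *\<^sub>R w) \<le> 1 * norm v" by simp
qed simp

lemma admissible_signed_noise:
  assumes "norm w \<le> 1"
  shows "admissible_noise centered_laws coin (signed_noise w)"
  unfolding admissible_noise_def
  using hilbert_process_signed_noise is_covariance_signed_noise onorm_covariance_signed_noise[OF assms]
    process_law_in_centered_laws[OF hilbert_process_signed_noise centered_signed_noise
      is_covariance_signed_noise] by blast


section \<open>A purely data driven method forces a closed range\<close>

lemma error_probability_tendsto_0:
  assumes "convergent_statistical_regularization TYPE('w) T s v u F \<alpha> W" "y \<in> ginv_domain T"
    "\<And>k. \<delta> k > 0" "\<And>k. admissible_noise W (M k :: 'w measure) (\<Xi> k)" "\<delta> \<longlonglongrightarrow> 0" "\<epsilon> > 0"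
  shows "(\<lambda>k. measure (M k) (error_event T s v u F \<alpha> y (\<delta> k) (M k) (\<Xi> k) \<epsilon>)) \<longlonglongrightarrow> 0"
proof -
  let ?P = "\<lambda>k \<epsilon>. error_event T s v u F \<alpha> y (\<delta> k) (M k) (\<Xi> k) \<epsilon>"
  have "(\<forall>k. \<delta> k > 0 \<and> admissible_noise W (M k) (\<Xi> k)) \<and> \<delta> \<longlonglongrightarrow> 0"
    using assms by simp
  then have "\<forall>\<epsilon>>0. (\<forall>k. ?P k \<epsilon> \<in> sets (M k)) \<and> (\<lambda>k. measure (M k) (?P k \<epsilon>)) \<longlonglongrightarrow> 0"
    using assms(1)[unfolded convergent_statistical_regularization_def, THEN conjunct2, THEN conjunct2,
        rule_format, OF assms(2), of \<delta> M \<Xi>] by blast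
  then show ?thesis using assms(6) by blast
qed

text \<open>
  The zero process is admissible noise, and with it the data are the same at every noise level. As \<open>\<alpha>\<close> ignores
  the noise level, the reconstruction error is constant in \<open>k\<close> and deterministic; convergence forces it to be 0.
\<close>

lemma data_driven_method_exact_on_exact_data:
  fixes T :: "'a::real_inner \<Rightarrow> 'b::real_inner"
  assumes dd: "purely_data_driven \<alpha>"
    and conv: "convergent_statistical_regularization TYPE(bool) T s v u F \<alpha> centered_laws"
    and y: "y \<in> ginv_domain T" and "\<delta> > 0"
  defines "Y \<equiv> (\<lambda>j. if s j > 0 then y \<bullet> u j else 0)"
  shows "regularize F s v (\<alpha> \<delta> Y) Y = ginv T y"
proof (rule ccontr)
  assume ne: "regularize F s v (\<alpha> \<delta> Y) Y \<noteq> ginv T y"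
  define \<epsilon> where "\<epsilon> = norm (ginv T y - regularize F s v (\<alpha> \<delta> Y) Y) / 2"
  define \<delta>' :: "nat \<Rightarrow> real" where "\<delta>' k = inverse (real (Suc k))" for k
  let ?E = "\<lambda>k. error_event T s v u F \<alpha> y (\<delta>' k) coin (signed_noise 0) \<epsilon>"
  have \<epsilon>: "\<epsilon> > 0" using ne by (simp add: \<epsilon>_def)
  have \<delta>': "\<delta>' k > 0" for k by (simp add: \<delta>'_def)
  have adm: "admissible_noise centered_laws coin (signed_noise (0 :: 'b))"
    by (rule admissible_signed_noise) simp
  have "\<delta>' \<longlonglongrightarrow> 0" unfolding \<delta>'_def by (rule LIMSEQ_inverse_real_of_nat)
  then have lim: "(\<lambda>k. measure coin (?E k)) \<longlonglongrightarrow> 0"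
    by (intro error_probability_tendsto_0[OF conv y] \<delta>' \<epsilon> adm)
  have "?E k = UNIV" for k
  proof -
    have "observation s u y (\<delta>' k) (signed_noise 0) \<omega> = Y" for \<omega>
      by (auto simp: observation_def signed_noise_def Y_def)
    moreover have "\<alpha> (\<delta>' k) Y = \<alpha> \<delta> Y"
      using dd \<delta>' \<open>\<delta> > 0\<close> unfolding purely_data_driven_def by blast
    ultimately have "\<omega> \<in> ?E k" for \<omega>
      unfolding error_event_def Let_def using \<epsilon> by (simp add: coin_def \<epsilon>_def)
    then show ?thesis by blast
  qed
  moreover have "measure coin UNIV = 1"
    by (simp add: coin_def)
  ultimately have "(\<lambda>k :: nat. 1 :: real) \<longlonglongrightarrow> 0"
    using lim by simp
  then show False by (simp add: LIMSEQ_const_iff)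
qed

text \<open>
  With probability 1/2 the observation of \<open>y = 0\<close> at noise level \<open>s\<^sub>k\<close> in the direction \<open>u\<^sub>k\<close> is the exact
  observation of \<open>s\<^sub>k u\<^sub>k = T v\<^sub>k\<close>. A method that does not know the noise level reconstructs \<open>v\<^sub>k\<close>, at distance 1
  from \<open>T\<^sup>+ 0 = 0\<close>, although \<open>s\<^sub>k \<longlonglongrightarrow> 0\<close>.
\<close>

lemma finite_rank_of_data_driven_method:
  fixes T :: "'a::real_inner \<Rightarrow> 'b::real_inner"
  assumes H: "hilbert_schmidt T" and S: "singular_system T s v u"
    and ex: "data_driven_method_exists T s v u centered_laws"
  shows "finite {j. s j > 0}"
proof (rule ccontr)
  assume "infinite {j. s j > 0}"
  then have pos: "\<And>j. s j > 0" using singular_values_all_pos_or_finite[OF S] by auto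
  have bl: "bounded_linear T" using H by (simp add: hilbert_schmidt_def)
  interpret bounded_linear T by (rule bl)
  obtain F \<alpha> where dd: "purely_data_driven \<alpha>"
    and conv': "convergent_statistical_regularization TYPE('b \<Rightarrow> real) T s v u F \<alpha> centered_laws"
    using ex unfolding data_driven_method_exists_def by blast
  have conv: "convergent_statistical_regularization TYPE(bool) T s v u F \<alpha> centered_laws"
    by (rule convergent_statistical_regularization_any_sample_space[OF conv'])
  note on = singular_system_orthonormal[OF S pos pos]
  have perp0: "0 \<in> orthogonal_comp (range T)" "0 \<in> orthogonal_comp {x. T x = 0}"
    by (simp_all add: orthogonal_comp_def orthogonal_def)
  have dom: "T x \<in> ginv_domain T" for x
    unfolding ginv_domain_def using perp0(1) by force
  have dom0: "0 \<in> ginv_domain T" using dom[of 0] by (simp add: zero)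
  have ginv0: "ginv T 0 = 0" using ginv_eq[OF bl perp0(2,1)] by (simp add: zero)
  let ?E = "\<lambda>k. error_event T s v u F \<alpha> 0 (s k) coin (signed_noise (u k)) (1/2)"
  have adm: "admissible_noise centered_laws coin (signed_noise (u k))" for k
    by (intro admissible_signed_noise) (simp add: norm_eq_sqrt_inner on)
  have "(\<lambda>k. (s k)\<^sup>2) \<longlonglongrightarrow> 0"
    by (rule summable_LIMSEQ_zero[OF hilbert_schmidt_summable_singular_values[OF H S]])
  then have "s \<longlonglongrightarrow> 0" by simp
  then have lim: "(\<lambda>k. measure coin (?E k)) \<longlonglongrightarrow> 0"
    by (intro error_probability_tendsto_0[OF conv dom0] pos adm) simp_all
  have "1/2 \<le> measure coin (?E k)" for k
  proof -
    let ?Y = "\<lambda>j. if s j > 0 then (s k *\<^sub>R u k) \<bullet> u j else 0"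
    have "regularize F s v (\<alpha> (s k) ?Y) ?Y = v k"
      using data_driven_method_exact_on_exact_data[OF dd conv dom[of "v k"] pos[of k]]
      unfolding image_right_singular_vector[OF S pos] ginv_left_singular_vector[OF bl S pos] .
    moreover have "observation s u 0 (s k) (signed_noise (u k)) True = ?Y"
      by (auto simp: observation_def signed_noise_def)
    moreover have "norm (v k) = 1" by (simp add: norm_eq_1 on)
    ultimately have "True \<in> ?E k"
      by (simp add: error_event_def ginv0 coin_def)
    then have "measure coin {True} \<le> measure coin (?E k)"
      unfolding coin_def by (intro measure_pmf.finite_measure_mono) auto
    then show ?thesis by (simp add: coin_def measure_pmf_single)
  qed
  then have "1/2 \<le> (0 :: real)" by (intro LIMSEQ_le_const[OF lim]) blast
  then show False by simp
qed


section \<open>Finite rank admits a purely data driven method\<close>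

lemma finite_rank_expansion:
  assumes S: "singular_system T s v u" and fin: "finite {j. s j > 0}"
  shows "T x = (\<Sum>j\<in>{j. s j > 0}. (s j * (x \<bullet> v j)) *\<^sub>R u j)"
proof -
  have "(\<lambda>j. (s j * (x \<bullet> v j)) *\<^sub>R u j) sums (\<Sum>j\<in>{j. s j > 0}. (s j * (x \<bullet> v j)) *\<^sub>R u j)"
    using singular_value_pos_or_zero[OF S] by (intro sums_finite fin) auto
  then show ?thesis
    using singular_system_sums[OF S] sums_unique2 by blast
qed

text \<open>
  The projection \<open>p\<close> of \<open>x\<close> onto the span of the \<open>v\<^sub>j\<close> has the same image as \<open>x\<close> and lies in \<open>ker(T)\<^sup>\<bottom>\<close>;
  its coefficients can be read off from \<open>y = T x + z\<close>, as \<open>z\<close> is orthogonal to every \<open>u\<^sub>j\<close>.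
\<close>

lemma finite_rank_ginv:
  assumes bl: "bounded_linear T" and S: "singular_system T s v u" and fin: "finite {j. s j > 0}"
    and y: "y \<in> ginv_domain T"
  shows "ginv T y = (\<Sum>j\<in>{j. s j > 0}. ((y \<bullet> u j) / s j) *\<^sub>R v j)"
proof -
  interpret bounded_linear T by (rule bl)
  define J where "J = {j. s j > 0}"
  have pos: "s j > 0" if "j \<in> J" for j using that by (simp add: J_def)
  obtain x z where yxz: "y = T x + z" and z: "z \<in> orthogonal_comp (range T)"
    using y by (auto simp: ginv_domain_def)
  have "z \<bullet> u j = 0" if "j \<in> J" for j
    using z left_singular_vector_in_range[OF bl S pos[OF that]]
    by (auto simp: orthogonal_comp_def orthogonal_def inner_commute)
  then have yu: "(y \<bullet> u j) / s j = x \<bullet> v j" if "j \<in> J" for j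
    using that pos[OF that]
    by (simp add: yxz inner_add_left inner_image_left_singular_vector[OF S])
  define p where "p = (\<Sum>j\<in>J. (x \<bullet> v j) *\<^sub>R v j)"
  have "T p = (\<Sum>j\<in>J. (s j * (x \<bullet> v j)) *\<^sub>R u j)"
    using pos by (simp add: p_def sum scaleR image_right_singular_vector[OF S] mult.commute)
  also have "\<dots> = T x"
    by (simp add: finite_rank_expansion[OF S fin] J_def)
  finally have "y = T p + z" by (simp add: yxz)
  moreover have "p \<in> orthogonal_comp {x. T x = 0}"
    unfolding p_def using right_singular_vector_in_kernel_complement[OF S pos]
    by (intro subspace_sum subspace_scale subspace_orthogonal_comp)
  ultimately have "ginv T y = p" using ginv_eq[OF bl _ z] by simp
  also have "\<dots> = (\<Sum>j\<in>J. ((y \<bullet> u j) / s j) *\<^sub>R v j)"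
    by (simp add: p_def yu)
  finally show ?thesis by (simp add: J_def)
qed

text \<open>
  A law in \<^const>\<open>centered_laws\<close> comes from some centered process, possibly on another sample space;
  expectations depend on the law only.
\<close>

lemma centered_if_law_centered:
  fixes M :: "'w measure" and \<Xi> :: "'b::real_inner \<Rightarrow> 'w \<Rightarrow> real"
  assumes hp: "hilbert_process M \<Xi>" and law: "process_law M \<Xi> \<in> centered_laws"
  shows "centered M \<Xi>"
proof -
  obtain M' \<Xi>' where eq: "process_law M \<Xi> = process_law (M' :: ('b \<Rightarrow> real) measure) \<Xi>'"
    and hp': "hilbert_process M' \<Xi>'" and c: "centered M' \<Xi>'"
    using law by (auto simp: centered_laws_def)
  have "(\<integral>\<omega>. \<Xi> w \<omega> \<partial>M) = (\<integral>\<omega>. \<Xi>' w \<omega> \<partial>M')" for w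
    using integral_process_law[OF hp coordinate_measurable, of w]
      integral_process_law[OF hp' coordinate_measurable, of w] eq by simp
  then show ?thesis using c by (simp add: centered_def)
qed

lemma admissible_noise_variance:
  assumes adm: "admissible_noise centered_laws M \<Xi>" and w: "norm w \<le> 1"
  shows "(\<integral>\<omega>. (\<Xi> w \<omega>)\<^sup>2 \<partial>M) \<le> 1"
proof -
  obtain C where C: "is_covariance M \<Xi> C" "onorm C \<le> 1"
    using adm by (auto simp: admissible_noise_def)
  have bl: "bounded_linear C" using C by (simp add: is_covariance_def)
  have "(\<integral>\<omega>. \<Xi> w \<omega> \<partial>M) = 0"
    using centered_if_law_centered adm by (auto simp: admissible_noise_def centered_def)
  then have "(\<integral>\<omega>. (\<Xi> w \<omega>)\<^sup>2 \<partial>M) = C w \<bullet> w"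
    using C(1) by (simp add: is_covariance_def power2_eq_square)
  also have "\<dots> \<le> norm (C w) * norm w" by (rule norm_cauchy_schwarz)
  also have "\<dots> \<le> (onorm C * norm w) * norm w"
    by (intro mult_right_mono onorm bl) simp
  also have "\<dots> \<le> (1 * 1) * 1"
    using C(2) w onorm_pos_le[OF bl] by (intro mult_mono) auto
  finally show ?thesis by simp
qed

text \<open>
  With a threshold at or below the smallest positive \<open>s\<^sub>j\<^sup>2\<close> spectral cutoff is \<open>T\<^sup>+\<close>. A constant parameter thus
  leaves the pure noise error \<open>\<delta> \<Sum>\<^sub>j \<langle>\<Xi>, u\<^sub>j\<rangle> v\<^sub>j / s\<^sub>j\<close>, whose second moment is at most \<open>\<delta>\<^sup>2 \<Sum>\<^sub>j s\<^sub>j\<^sup>-\<^sup>2\<close>.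
\<close>

lemma data_driven_method_of_finite_rank:
  fixes T :: "'a::{real_inner,banach,second_countable_topology} \<Rightarrow> 'b::real_inner"
  assumes bl: "bounded_linear T" and S: "singular_system T s v u" and fin: "finite {j. s j > 0}"
  shows "data_driven_method_exists T s v u centered_laws"
proof -
  define J where "J = {j. s j > 0}"
  have J: "finite J" using fin by (simp add: J_def)
  have pos: "s j > 0" if "j \<in> J" for j using that by (simp add: J_def)
  have on: "v i \<bullet> v j = (if i = j then 1 else 0)" if "i \<in> J" "j \<in> J" for i j
    by (rule singular_system_orthonormal(1)[OF S pos[OF that(1)] pos[OF that(2)]])
  \<comment> \<open>The element 1 keeps the minimum defined for \<open>T = 0\<close>.\<close>
  define a where "a = Min (insert 1 ((\<lambda>j. (s j)\<^sup>2) ` J))"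
  have a: "a > 0" using J pos unfolding a_def by (subst Min_gr_iff) fastforce+
  have a_le: "a \<le> (s j)\<^sup>2" if "j \<in> J" for j
    unfolding a_def using that J by (intro Min_le) auto
  define \<alpha> :: "real \<Rightarrow> (nat \<Rightarrow> real) \<Rightarrow> real" where "\<alpha> \<delta> Y = a" for \<delta> Y
  have reg: "regularize spectral_cutoff s v a Y = (\<Sum>j\<in>J. (Y j / s j) *\<^sub>R v j)" for Y
  proof -
    have "regularize spectral_cutoff s v a Y = (\<Sum>j\<in>J. (spectral_cutoff a ((s j)\<^sup>2) * s j * Y j) *\<^sub>R v j)"
      unfolding regularize_def using singular_value_pos_or_zero[OF S]
      by (intro suminf_finite J) (auto simp: J_def)
    also have "\<dots> = (\<Sum>j\<in>J. (Y j / s j) *\<^sub>R v j)"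
      using pos a_le by (intro sum.cong) (auto simp: mult_spectral_cutoff_square)
    finally show ?thesis .
  qed
  define K where "K = (\<Sum>j\<in>J. 1 / (s j)\<^sup>2)"
  have prob: "measure M (error_event T s v u spectral_cutoff \<alpha> y \<delta> M \<Xi> \<epsilon>) \<le> \<delta>\<^sup>2 * (K / \<epsilon>\<^sup>2)"
    if y: "y \<in> ginv_domain T" and adm: "admissible_noise centered_laws M \<Xi>" and \<epsilon>: "\<epsilon> > 0"
    for y \<delta> \<epsilon> and M :: "('b \<Rightarrow> real) measure" and \<Xi>
  proof -
    have hp: "hilbert_process M \<Xi>" using adm by (simp add: admissible_noise_def)
    interpret prob_space M using hp by (simp add: hilbert_process_def)
    have int: "integrable M (\<lambda>\<omega>. (\<Xi> w \<omega>)\<^sup>2)" and [measurable]: "\<Xi> w \<in> borel_measurable M" for w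
      using hp by (auto simp: hilbert_process_def)
    define E where "E \<omega> = (\<Sum>j\<in>J. \<delta>\<^sup>2 * ((\<Xi> (u j) \<omega>)\<^sup>2 / (s j)\<^sup>2))" for \<omega>
    have [measurable]: "E \<in> borel_measurable M" unfolding E_def by measurable
    have intE: "integrable M E" unfolding E_def using int by auto
    have err: "(norm (ginv T y - regularize spectral_cutoff s v a (observation s u y \<delta> \<Xi> \<omega>)))\<^sup>2 = E \<omega>" for \<omega>
    proof -
      have "ginv T y - regularize spectral_cutoff s v a (observation s u y \<delta> \<Xi> \<omega>)
              = (\<Sum>j\<in>J. (- \<delta> * \<Xi> (u j) \<omega> / s j) *\<^sub>R v j)"
        unfolding reg finite_rank_ginv[OF bl S fin y] J_def[symmetric] sum_subtractf[symmetric]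
          scaleR_diff_left[symmetric]
        using pos by (intro sum.cong) (auto simp: observation_def add_divide_distrib)
      then show ?thesis
        by (simp only: norm_sum_orthonormal[OF J on] E_def)
          (simp add: power_divide power_mult_distrib)
    qed
    have "error_event T s v u spectral_cutoff \<alpha> y \<delta> M \<Xi> \<epsilon> \<subseteq> {\<omega> \<in> space M. E \<omega> \<ge> \<epsilon>\<^sup>2}"
    proof
      fix \<omega> assume "\<omega> \<in> error_event T s v u spectral_cutoff \<alpha> y \<delta> M \<Xi> \<epsilon>"
      then have "\<omega> \<in> space M"
        and "\<epsilon> < norm (ginv T y - regularize spectral_cutoff s v a (observation s u y \<delta> \<Xi> \<omega>))"
        by (auto simp: error_event_def \<alpha>_def)
      then show "\<omega> \<in> {\<omega> \<in> space M. E \<omega> \<ge> \<epsilon>\<^sup>2}"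
        unfolding err[symmetric] using \<epsilon> by (auto intro!: power_mono)
    qed
    then have "measure M (error_event T s v u spectral_cutoff \<alpha> y \<delta> M \<Xi> \<epsilon>)
        \<le> measure M {\<omega> \<in> space M. E \<omega> \<ge> \<epsilon>\<^sup>2}"
      by (intro finite_measure_mono) auto
    also have "\<dots> \<le> (\<integral>\<omega>. E \<omega> \<partial>M) / \<epsilon>\<^sup>2"
      using \<epsilon> by (intro integral_Markov_inequality_measure[OF intE, of "{}"])
        (auto simp: E_def intro!: sum_nonneg)
    also have "(\<integral>\<omega>. E \<omega> \<partial>M) = (\<Sum>j\<in>J. \<delta>\<^sup>2 * ((\<integral>\<omega>. (\<Xi> (u j) \<omega>)\<^sup>2 \<partial>M) / (s j)\<^sup>2))"
      unfolding E_def using int by (subst Bochner_Integration.integral_sum) auto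
    also have "\<dots> \<le> (\<Sum>j\<in>J. \<delta>\<^sup>2 * (1 / (s j)\<^sup>2))"
    proof (intro sum_mono mult_left_mono divide_right_mono admissible_noise_variance[OF adm])
      fix j assume "j \<in> J"
      then show "norm (u j) \<le> 1"
        using singular_system_orthonormal(2)[OF S pos pos, of j j] by (simp add: norm_eq_sqrt_inner)
    qed auto
    also have "\<dots> = \<delta>\<^sup>2 * K" by (simp add: K_def sum_distrib_left)
    finally show ?thesis using \<epsilon> by (simp add: divide_right_mono)
  qed
  have "convergent_statistical_regularization TYPE('b \<Rightarrow> real) T s v u spectral_cutoff \<alpha> centered_laws"
    unfolding convergent_statistical_regularization_def
  proof (intro conjI ballI allI impI)
    show "regularization_filter T s spectral_cutoff" by (rule spectral_cutoff_filter)
    show "parameter_choice \<alpha>"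
      using a by (simp add: parameter_choice_def \<alpha>_def[abs_def] space_restrict_space)
    fix y and \<delta> :: "nat \<Rightarrow> real" and M :: "nat \<Rightarrow> ('b \<Rightarrow> real) measure"
      and \<Xi> :: "nat \<Rightarrow> 'b \<Rightarrow> ('b \<Rightarrow> real) \<Rightarrow> real" and \<epsilon> :: real
    assume y: "y \<in> ginv_domain T" and \<epsilon>: "\<epsilon> > 0"
      and h: "(\<forall>k. \<delta> k > 0 \<and> admissible_noise centered_laws (M k) (\<Xi> k)) \<and> \<delta> \<longlonglongrightarrow> 0"
    let ?E = "\<lambda>k. error_event T s v u spectral_cutoff \<alpha> y (\<delta> k) (M k) (\<Xi> k) \<epsilon>"
    have "\<alpha> \<delta>' \<in> borel_measurable (Pi\<^sub>M UNIV (\<lambda>_. borel))" for \<delta>'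
      by (simp add: \<alpha>_def[abs_def])
    then show "?E k \<in> sets (M k)" for k
      using h by (intro error_event_spectral_cutoff_measurable) (auto simp: admissible_noise_def)
    have "(\<lambda>k. (\<delta> k)\<^sup>2 * (K / \<epsilon>\<^sup>2)) \<longlonglongrightarrow> 0\<^sup>2 * (K / \<epsilon>\<^sup>2)"
      using h by (intro tendsto_intros) auto
    then have lim: "(\<lambda>k. (\<delta> k)\<^sup>2 * (K / \<epsilon>\<^sup>2)) \<longlonglongrightarrow> 0" by simp
    show "(\<lambda>k. measure (M k) (?E k)) \<longlonglongrightarrow> 0"
      by (rule tendsto_sandwich[OF _ _ tendsto_const lim])
        (use h prob[OF y _ \<epsilon>] in \<open>auto intro!: always_eventually\<close>)
  qed
  moreover have "purely_data_driven \<alpha>"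
    by (simp add: purely_data_driven_def \<alpha>_def)
  ultimately show ?thesis unfolding data_driven_method_exists_def by blast
qed


section \<open>An ill-posed problem with identifiable noise level\<close>

lemma summable_ell2_dominated:
  assumes "\<And>i. \<bar>a i\<bar> \<le> \<bar>nth_ell2 x i\<bar>"
  shows "summable (\<lambda>i. (a i)\<^sup>2)"
  by (rule summable_comparison_test'[OF summable_ell2[of x], of 0])
    (simp add: assms flip: abs_le_square_iff)

lemma norm_ell2_mono:
  assumes "\<And>i. \<bar>nth_ell2 x i\<bar> \<le> \<bar>nth_ell2 y i\<bar>"
  shows "norm x \<le> norm y"
proof (rule power2_le_imp_le)
  show "(norm x)\<^sup>2 \<le> (norm y)\<^sup>2"
    unfolding norm_ell2_power2
    using assms by (intro suminf_le summable_ell2) (simp add: abs_le_square_iff)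
qed simp

lemma nth_sum_ell2: "nth_ell2 (\<Sum>j\<in>J. f j) i = (\<Sum>j\<in>J. nth_ell2 (f j) i)"
  by (induction J rule: infinite_finite_induct) auto

definition unit_ell2 :: "nat \<Rightarrow> ell2" where
  "unit_ell2 j = Abs_ell2 (\<lambda>i. if i = j then 1 else 0)"

lemma nth_unit_ell2 [simp]: "nth_ell2 (unit_ell2 j) i = (if i = j then 1 else 0)"
proof -
  have "summable (\<lambda>i. (if i = j then 1 else 0 :: real)\<^sup>2)"
    by (rule summable_finite[of "{j}"]) auto
  then show ?thesis by (simp add: unit_ell2_def nth_Abs_ell2)
qed

lemma inner_unit_ell2 [simp]: "x \<bullet> unit_ell2 j = nth_ell2 x j"
proof -
  have "(\<lambda>i. nth_ell2 x i * nth_ell2 (unit_ell2 j) i) = (\<lambda>i. if i = j then nth_ell2 x i else 0)"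
    by auto
  then show ?thesis
    unfolding inner_ell2_def using sums_unique[OF sums_single[of j "nth_ell2 x"]] by simp
qed

lemma unit_ell2_expansion: "(\<lambda>j. nth_ell2 x j *\<^sub>R unit_ell2 j) sums x"
proof -
  have *: "(norm (x - (\<Sum>j<n. nth_ell2 x j *\<^sub>R unit_ell2 j)))\<^sup>2 = (norm x)\<^sup>2 - (\<Sum>j<n. (nth_ell2 x j)\<^sup>2)" for n
    by (subst norm_diff_sum_orthonormal) auto
  have "(\<lambda>n. \<Sum>j<n. (nth_ell2 x j)\<^sup>2) \<longlonglongrightarrow> (norm x)\<^sup>2"
    using summable_sums[OF summable_ell2[of x]] by (simp add: norm_ell2_power2 sums_def)
  then have "(\<lambda>n. (norm x)\<^sup>2 - (\<Sum>j<n. (nth_ell2 x j)\<^sup>2)) \<longlonglongrightarrow> (norm x)\<^sup>2 - (norm x)\<^sup>2"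
    by (intro tendsto_diff tendsto_const)
  then have "(\<lambda>n. (norm (x - (\<Sum>j<n. nth_ell2 x j *\<^sub>R unit_ell2 j)))\<^sup>2) \<longlonglongrightarrow> 0"
    unfolding * by simp
  then have "(\<lambda>n. x - (\<Sum>j<n. nth_ell2 x j *\<^sub>R unit_ell2 j)) \<longlonglongrightarrow> 0"
    by (simp add: tendsto_norm_zero_iff)
  then have "(\<lambda>n. x - (x - (\<Sum>j<n. nth_ell2 x j *\<^sub>R unit_ell2 j))) \<longlonglongrightarrow> x - 0"
    by (intro tendsto_diff tendsto_const)
  then show ?thesis by (simp add: sums_def)
qed

lemma orthonormal_basis_unit_ell2: "orthonormal_basis (range unit_ell2)"
  unfolding orthonormal_basis_def
proof (intro conjI)
  show "pairwise orthogonal (range unit_ell2)"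
    by (auto simp: pairwise_def orthogonal_def)
  show "\<forall>e\<in>range unit_ell2. norm e = 1"
    by (auto simp: norm_eq_1)
  have "x \<in> closure (span (range unit_ell2))" for x
    unfolding closure_sequential
  proof (intro exI conjI allI)
    show "(\<Sum>j<n. nth_ell2 x j *\<^sub>R unit_ell2 j) \<in> span (range unit_ell2)" for n
      by (intro span_sum span_scale span_base) auto
    show "(\<lambda>n. \<Sum>j<n. nth_ell2 x j *\<^sub>R unit_ell2 j) \<longlonglongrightarrow> x"
      using unit_ell2_expansion[of x] by (simp add: sums_def)
  qed
  then show "closure (span (range unit_ell2)) = UNIV" by auto
qed

definition geometric_diagonal :: "ell2 \<Rightarrow> ell2" where
  "geometric_diagonal x = Abs_ell2 (\<lambda>j. (1/4) ^ j * nth_ell2 x j)"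

lemma nth_geometric_diagonal [simp]: "nth_ell2 (geometric_diagonal x) j = (1/4) ^ j * nth_ell2 x j"
proof -
  have "\<bar>(1/4) ^ j * nth_ell2 x j\<bar> \<le> \<bar>nth_ell2 x j\<bar>" for j
    using mult_right_mono[OF power_le_one[of "1/4 :: real" j], of "\<bar>nth_ell2 x j\<bar>"]
    by (simp add: abs_mult)
  then show ?thesis
    unfolding geometric_diagonal_def by (subst nth_Abs_ell2[OF summable_ell2_dominated]) auto
qed

lemma bounded_linear_geometric_diagonal: "bounded_linear geometric_diagonal"
proof (rule bounded_linear_intro)
  show "norm (geometric_diagonal x) \<le> norm x * 1" for x
  proof -
    have "\<bar>nth_ell2 (geometric_diagonal x) j\<bar> \<le> \<bar>nth_ell2 x j\<bar>" for j
      using mult_right_mono[OF power_le_one[of "1/4 :: real" j], of "\<bar>nth_ell2 x j\<bar>"]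
      by (simp add: abs_mult)
    then show ?thesis using norm_ell2_mono by simp
  qed
qed (auto intro!: ell2_eqI simp: algebra_simps)

lemma geometric_diagonal_unit: "geometric_diagonal (unit_ell2 j) = (1/4) ^ j *\<^sub>R unit_ell2 j"
  by (rule ell2_eqI) simp

lemma singular_system_geometric_diagonal:
  "singular_system geometric_diagonal (\<lambda>j. (1/4) ^ j) unit_ell2 unit_ell2"
  unfolding singular_system_def
proof (intro conjI allI)
  show "decseq (\<lambda>j. (1/4 :: real) ^ j)"
    by (auto simp: decseq_def intro: power_decreasing)
  show "(\<lambda>j. ((1/4) ^ j * (x \<bullet> unit_ell2 j)) *\<^sub>R unit_ell2 j) sums geometric_diagonal x" for x
    using unit_ell2_expansion[of "geometric_diagonal x"] by simp
qed auto

lemma hilbert_schmidt_geometric_diagonal: "hilbert_schmidt geometric_diagonal"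
  unfolding hilbert_schmidt_def
proof (intro conjI exI)
  show "bounded_linear geometric_diagonal" by (rule bounded_linear_geometric_diagonal)
  show "orthonormal_basis (range unit_ell2)" by (rule orthonormal_basis_unit_ell2)
  have inj: "inj unit_ell2"
    by (rule injI) (metis nth_unit_ell2 zero_neq_one)
  have "(norm (geometric_diagonal (unit_ell2 j)))\<^sup>2 = (1/16) ^ j" for j
    by (simp add: geometric_diagonal_unit power2_norm_eq_inner del: norm_scaleR flip: power_mult_distrib)
  then have "summable (\<lambda>j. (norm (geometric_diagonal (unit_ell2 j)))\<^sup>2)"
    by (simp add: summable_geometric)
  then have "(\<lambda>j. (norm (geometric_diagonal (unit_ell2 j)))\<^sup>2) summable_on UNIV"
    by (intro norm_summable_imp_summable_on) simp
  then show "(\<lambda>e. (norm (geometric_diagonal e))\<^sup>2) summable_on range unit_ell2"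
    by (subst summable_on_reindex[OF inj]) (simp add: o_def)
qed

lemma ginv_geometric_diagonal:
  assumes "z \<in> orthogonal_comp (range geometric_diagonal)"
  shows "ginv geometric_diagonal (geometric_diagonal x + z) = x"
proof (rule ginv_eq[OF bounded_linear_geometric_diagonal _ assms])
  have inj: "y = 0" if "geometric_diagonal y = 0" for y
  proof (rule ell2_eqI)
    fix i show "nth_ell2 y i = nth_ell2 0 i"
      using arg_cong[OF that, of "\<lambda>y. nth_ell2 y i"] by simp
  qed
  show "x \<in> orthogonal_comp {x. geometric_diagonal x = 0}"
    by (auto simp: orthogonal_comp_def orthogonal_def dest: inj)
qed

text \<open>
  The coefficients decay more slowly than those of any element of the range of
  \<^const>\<open>geometric_diagonal\<close>, which makes noise in this direction visible in every observation.
\<close>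

definition rough_direction :: ell2 where
  "rough_direction = Abs_ell2 (\<lambda>j. (1/2) ^ Suc j)"

lemma
  shows nth_rough_direction [simp]: "nth_ell2 rough_direction j = (1/2) ^ Suc j"
    and norm_rough_direction: "norm rough_direction \<le> 1"
proof -
  have le: "((1/2 :: real) ^ Suc j)\<^sup>2 \<le> (1/2) ^ Suc j" for j
    using mult_left_mono[OF power_le_one[of "1/2 :: real" "Suc j"], of "(1/2) ^ Suc j"]
    by (simp add: power2_eq_square)
  have sm: "summable (\<lambda>j. ((1/2 :: real) ^ Suc j)\<^sup>2)"
    using le by (intro summable_comparison_test'[OF sums_summable[OF power_half_series], of 0]) simp
  then show nth: "nth_ell2 rough_direction j = (1/2) ^ Suc j" for j
    unfolding rough_direction_def by (subst nth_Abs_ell2) auto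
  have "(norm rough_direction)\<^sup>2 = (\<Sum>j. ((1/2) ^ Suc j)\<^sup>2)"
    by (simp only: norm_ell2_power2 nth)
  also have "\<dots> \<le> (\<Sum>j. (1/2) ^ Suc j)"
    by (intro suminf_le le sm sums_summable[OF power_half_series])
  also have "\<dots> = 1" by (rule sums_unique[OF power_half_series, symmetric])
  finally show "norm rough_direction \<le> 1" by (simp add: power2_le_imp_le)
qed

text \<open>The value 1 is only a default that keeps the parameter positive.\<close>

definition estimated_noise_level :: "(nat \<Rightarrow> real) \<Rightarrow> real" where
  "estimated_noise_level Y =
     (let l = lim (\<lambda>j. \<bar>Y j\<bar> / nth_ell2 rough_direction j) in if l > 0 then l else 1)"

lemma estimated_noise_level_pos: "estimated_noise_level Y > 0"
  by (simp add: estimated_noise_level_def Let_def)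

lemma estimated_noise_level_measurable:
  "estimated_noise_level \<in> borel_measurable (Pi\<^sub>M UNIV (\<lambda>_. borel))"
  unfolding estimated_noise_level_def Let_def by measurable

text \<open>
  The data of \<open>y = T x\<close> and of the noise are \<open>4\<^sup>-\<^sup>j x\<^sub>j\<close> and \<open>\<plusminus>\<delta> 2\<^sup>-\<^sup>j\<^sup>-\<^sup>1\<close>: the signal disappears
  relative to the noise as \<open>j \<rightarrow> \<infinity>\<close>.
\<close>

lemma estimated_noise_level_exact:
  assumes Y: "\<And>j. Y j = (1/4) ^ j * nth_ell2 x j + \<delta> * (\<sigma> * nth_ell2 rough_direction j)"
    and \<sigma>: "\<bar>\<sigma>\<bar> = 1" and \<delta>: "\<delta> > 0"
  shows "estimated_noise_level Y = \<delta>"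
proof -
  have "(\<lambda>j. norm x * (1/2) ^ j) \<longlonglongrightarrow> norm x * 0"
    by (intro tendsto_intros LIMSEQ_power_zero) simp
  then have "(\<lambda>j. (1/2) ^ j * nth_ell2 x j) \<longlonglongrightarrow> 0"
    using abs_nth_le_norm_ell2[of x]
    by (intro Lim_null_comparison[of "\<lambda>j. (1/2) ^ j * nth_ell2 x j" "\<lambda>j. norm x * (1/2) ^ j"])
      (auto simp: abs_mult mult.commute intro!: always_eventually mult_right_mono)
  then have "(\<lambda>j. \<bar>2 * ((1/2) ^ j * nth_ell2 x j) + \<delta> * \<sigma>\<bar>) \<longlonglongrightarrow> \<bar>2 * 0 + \<delta> * \<sigma>\<bar>"
    by (intro tendsto_intros)
  moreover have "\<bar>Y j\<bar> / nth_ell2 rough_direction j = \<bar>2 * ((1/2) ^ j * nth_ell2 x j) + \<delta> * \<sigma>\<bar>" for j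
  proof -
    have p: "(1/4 :: real) ^ j = (1/2) ^ j * (1/2) ^ j"
      by (simp flip: power_mult_distrib)
    have "Y j = (2 * ((1/2) ^ j * nth_ell2 x j) + \<delta> * \<sigma>) * (1/2) ^ Suc j"
      by (simp add: Y p algebra_simps)
    then have "\<bar>Y j\<bar> = \<bar>2 * ((1/2) ^ j * nth_ell2 x j) + \<delta> * \<sigma>\<bar> * (1/2) ^ Suc j"
      by (simp only: abs_mult) simp
    then show ?thesis unfolding nth_rough_direction by simp
  qed
  ultimately have "lim (\<lambda>j. \<bar>Y j\<bar> / nth_ell2 rough_direction j) = \<delta>"
    using \<sigma> \<delta> by (intro limI) (simp add: abs_mult)
  then show ?thesis using \<delta> by (simp add: estimated_noise_level_def)
qed

text \<open>
  With \<open>\<alpha> = \<delta>\<close> the noise is amplified by at most \<open>1/\<surd>\<delta>\<close>, leaving an error of at most \<open>\<surd>\<delta>\<close>, and the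
  part of \<open>x\<close> that is cut off tends to 0. The bound \<open>\<eta>\<close> is uniform in the sign \<open>\<sigma>\<close>, so it holds on both
  outcomes of the noise.
\<close>

lemma cutoff_at_noise_level_converges:
  assumes "\<epsilon> > 0"
  obtains \<eta> where "\<eta> > 0" and
    "\<And>\<delta> \<sigma> Y. \<lbrakk>0 < \<delta>; \<delta> < \<eta>; \<bar>\<sigma>\<bar> = 1;
        \<And>j. Y j = (1/4) ^ j * nth_ell2 x j + \<delta> * (\<sigma> * nth_ell2 rough_direction j)\<rbrakk>
      \<Longrightarrow> norm (x - regularize spectral_cutoff (\<lambda>j. (1/4) ^ j) unit_ell2 \<delta> Y) \<le> \<epsilon>"
proof -
  have "(\<lambda>n. \<Sum>j<n. nth_ell2 x j *\<^sub>R unit_ell2 j) \<longlonglongrightarrow> x"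
    using unit_ell2_expansion[of x] by (simp add: sums_def)
  then obtain N where N: "dist (\<Sum>j<N. nth_ell2 x j *\<^sub>R unit_ell2 j) x < \<epsilon> / 2"
    using assms unfolding lim_sequentially by (meson half_gt_zero order_refl)
  define s :: "nat \<Rightarrow> real" where "s j = (1/4) ^ j" for j
  have s: "s j > 0" for j by (simp add: s_def)
  define \<eta> where "\<eta> = min ((s N)\<^sup>2) ((\<epsilon> / 2)\<^sup>2)"
  have "\<eta> > 0" using assms s[of N] by (simp add: \<eta>_def)
  moreover have "norm (x - regularize spectral_cutoff s unit_ell2 \<delta> Y) \<le> \<epsilon>"
    if \<delta>: "0 < \<delta>" "\<delta> < \<eta>" and \<sigma>: "\<bar>\<sigma>\<bar> = 1"
      and Y: "\<And>j. Y j = (1/4) ^ j * nth_ell2 x j + \<delta> * (\<sigma> * nth_ell2 rough_direction j)" for \<delta> \<sigma> Y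
  proof -
    define J where "J = {j. \<delta> \<le> (s j)\<^sup>2}"
    have "(\<lambda>j. (s j)\<^sup>2) \<longlonglongrightarrow> 0\<^sup>2"
      unfolding s_def by (intro tendsto_intros LIMSEQ_power_zero) simp
    then have "\<forall>\<^sub>F j in sequentially. (s j)\<^sup>2 < \<delta>"
      using \<delta> by (intro order_tendstoD(2)) auto
    then have J: "finite J"
      unfolding J_def by (simp add: eventually_cofinite not_less flip: cofinite_eq_sequentially)
    have NJ: "j \<in> J" if "j < N" for j
    proof -
      have "(s N)\<^sup>2 \<le> (s j)\<^sup>2"
        unfolding s_def using that by (intro power_mono power_decreasing) auto
      then show ?thesis using \<delta> by (auto simp: J_def \<eta>_def)
    qed
    define a where "a = x - (\<Sum>j\<in>J. nth_ell2 x j *\<^sub>R unit_ell2 j)"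
    define b where "b = (\<Sum>j\<in>J. (\<delta> * (\<sigma> * nth_ell2 rough_direction j) / s j) *\<^sub>R unit_ell2 j)"
    have "regularize spectral_cutoff s unit_ell2 \<delta> Y
        = (\<Sum>j\<in>J. (spectral_cutoff \<delta> ((s j)\<^sup>2) * s j * Y j) *\<^sub>R unit_ell2 j)"
      unfolding regularize_def using s
      by (intro suminf_finite J) (auto simp: mult_spectral_cutoff_square J_def)
    also have "\<dots> = (\<Sum>j\<in>J. (nth_ell2 x j) *\<^sub>R unit_ell2 j
                        + (\<delta> * (\<sigma> * nth_ell2 rough_direction j) / s j) *\<^sub>R unit_ell2 j)"
    proof (intro sum.cong refl)
      fix j assume "j \<in> J"
      then have "spectral_cutoff \<delta> ((s j)\<^sup>2) * s j * Y j = 1 / s j * Y j"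
        using s by (simp add: mult_spectral_cutoff_square J_def)
      also have "\<dots> = nth_ell2 x j + \<delta> * (\<sigma> * nth_ell2 rough_direction j) / s j"
        unfolding Y s_def[symmetric] using s[of j] by (simp add: add_divide_distrib)
      finally show "(spectral_cutoff \<delta> ((s j)\<^sup>2) * s j * Y j) *\<^sub>R unit_ell2 j
          = nth_ell2 x j *\<^sub>R unit_ell2 j
            + (\<delta> * (\<sigma> * nth_ell2 rough_direction j) / s j) *\<^sub>R unit_ell2 j"
        by (simp only: scaleR_add_left)
    qed
    finally have "x - regularize spectral_cutoff s unit_ell2 \<delta> Y = a - b"
      by (simp only: a_def b_def sum.distrib) simp
    moreover have "norm a \<le> \<epsilon> / 2"
    proof -
      have "norm a \<le> norm (x - (\<Sum>j<N. nth_ell2 x j *\<^sub>R unit_ell2 j))"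
      proof (rule norm_ell2_mono)
        fix i
        have "nth_ell2 (\<Sum>j\<in>I. nth_ell2 x j *\<^sub>R unit_ell2 j) i = (if i \<in> I then nth_ell2 x i else 0)"
          if "finite I" for I
          using that by (simp add: nth_sum_ell2 if_distrib[of "\<lambda>t. _ * t"] cong: if_cong)
        then show "\<bar>nth_ell2 a i\<bar> \<le> \<bar>nth_ell2 (x - (\<Sum>j<N. nth_ell2 x j *\<^sub>R unit_ell2 j)) i\<bar>"
          using NJ[of i] J by (auto simp: a_def)
      qed
      then show ?thesis using N by (simp add: dist_norm norm_minus_commute)
    qed
    moreover have "norm b \<le> \<epsilon> / 2"
    proof -
      have sq: "\<delta> * (1 / sqrt \<delta>) = sqrt \<delta>"
        using \<delta> by (simp add: real_div_sqrt)
      have "norm b \<le> norm (sqrt \<delta> *\<^sub>R rough_direction)"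
      proof (rule norm_ell2_mono)
        fix i
        have "nth_ell2 b i = (if i \<in> J then \<delta> * (\<sigma> * nth_ell2 rough_direction i) / s i else 0)"
          using J by (simp add: b_def nth_sum_ell2 if_distrib[of "\<lambda>t. _ * t"] cong: if_cong)
        moreover have "\<bar>\<delta> * (\<sigma> * nth_ell2 rough_direction i) / s i\<bar>
            \<le> sqrt \<delta> * \<bar>nth_ell2 rough_direction i\<bar>" if "i \<in> J"
        proof -
          have "\<delta> * (1 / s i) \<le> \<delta> * (1 / sqrt \<delta>)"
            using \<delta> s that inverse_le_inverse_sqrt[of \<delta> "s i"] by (intro mult_left_mono) (auto simp: J_def)
          then have "\<delta> * (1 / s i) * \<bar>nth_ell2 rough_direction i\<bar> \<le> sqrt \<delta> * \<bar>nth_ell2 rough_direction i\<bar>"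
            unfolding sq by (rule mult_right_mono) simp
          then show ?thesis
            using \<sigma> \<delta> s[of i] by (simp add: abs_mult del: nth_rough_direction)
        qed
        ultimately show "\<bar>nth_ell2 b i\<bar> \<le> \<bar>nth_ell2 (sqrt \<delta> *\<^sub>R rough_direction) i\<bar>"
          using \<delta> by (simp add: abs_mult del: nth_rough_direction)
      qed
      also have "\<dots> \<le> sqrt \<delta> * 1"
        using norm_rough_direction \<delta> by (simp add: mult_left_le)
      also have "\<dots> \<le> \<epsilon> / 2"
        using \<delta> assms unfolding mult_1_right by (intro real_le_lsqrt) (auto simp: \<eta>_def)
      finally show ?thesis .
    qed
    ultimately show ?thesis using norm_triangle_ineq4[of a b] by simp
  qed
  ultimately show ?thesis using that unfolding s_def by blast
qed

text \<open>
  A process with the law of the signed noise may live on any sample space, but its coefficient sequence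
  takes almost surely one of two values: this is an event of the path space, as it involves only countably
  many coordinates.
\<close>

lemma noise_coefficients_of_law:
  assumes hp: "hilbert_process M \<Xi>" and law: "process_law M \<Xi> = process_law coin (signed_noise w)"
  shows "AE \<omega> in M. \<exists>\<sigma>. \<bar>\<sigma>\<bar> = 1 \<and> (\<forall>j. \<Xi> (unit_ell2 j) \<omega> = \<sigma> * nth_ell2 w j)"
proof -
  let ?N = "Pi\<^sub>M UNIV (\<lambda>_. borel) :: (ell2 \<Rightarrow> real) measure"
  define P where "P p \<longleftrightarrow> (\<forall>j. p (unit_ell2 j) = nth_ell2 w j) \<or> (\<forall>j. p (unit_ell2 j) = - nth_ell2 w j)"
    for p :: "ell2 \<Rightarrow> real"
  note [measurable] = coordinate_measurable
  have P: "{p \<in> space ?N. P p} \<in> sets ?N" unfolding P_def by measurable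
  have "AE \<omega> in coin. P (\<lambda>v. signed_noise w v \<omega>)"
    by (auto simp: P_def signed_noise_def)
  then have "AE p in process_law M \<Xi>. P p"
    unfolding law unfolding process_law_def
    using AE_distr_iff[OF path_measurable[OF hilbert_process_signed_noise] P] by blast
  then have "AE \<omega> in M. P (\<lambda>v. \<Xi> v \<omega>)"
    using AE_distr_iff[OF path_measurable[OF hp] P] unfolding process_law_def by blast
  then show ?thesis
  proof (rule AE_mp, intro AE_I2 impI)
    fix \<omega> assume "P (\<lambda>v. \<Xi> v \<omega>)"
    then show "\<exists>\<sigma>. \<bar>\<sigma>\<bar> = 1 \<and> (\<forall>j. \<Xi> (unit_ell2 j) \<omega> = \<sigma> * nth_ell2 w j)"
      unfolding P_def by (auto intro: exI[of _ 1] exI[of _ "-1"])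
  qed
qed

text \<open>
  Almost surely the estimated noise level is the true one, so the reconstruction error obeys a deterministic
  bound and the error events are null for all large \<open>k\<close>.
\<close>

lemma data_driven_method_for_rough_noise:
  "data_driven_method_exists geometric_diagonal (\<lambda>j. (1/4) ^ j) unit_ell2 unit_ell2
     {process_law coin (signed_noise rough_direction)}"
proof -
  let ?T = geometric_diagonal and ?s = "\<lambda>j. (1/4 :: real) ^ j"
  let ?W = "{process_law coin (signed_noise rough_direction)}"
  define \<alpha> :: "real \<Rightarrow> (nat \<Rightarrow> real) \<Rightarrow> real" where "\<alpha> \<delta> = estimated_noise_level" for \<delta>
  have "convergent_statistical_regularization TYPE(ell2 \<Rightarrow> real) ?T ?s unit_ell2 unit_ell2
          spectral_cutoff \<alpha> ?W"
    unfolding convergent_statistical_regularization_def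
  proof (intro conjI ballI allI impI)
    show "regularization_filter ?T ?s spectral_cutoff" by (rule spectral_cutoff_filter)
    note [measurable] = estimated_noise_level_measurable
    have "(\<lambda>x. estimated_noise_level (snd x)) \<in>
        restrict_space borel {0 <..} \<Otimes>\<^sub>M Pi\<^sub>M UNIV (\<lambda>_. borel) \<rightarrow>\<^sub>M borel"
      by measurable
    then show "parameter_choice \<alpha>"
      unfolding parameter_choice_def \<alpha>_def
      by (intro measurable_restrict_space2) (auto simp: case_prod_beta' estimated_noise_level_pos)
    fix y and \<delta> :: "nat \<Rightarrow> real" and M :: "nat \<Rightarrow> (ell2 \<Rightarrow> real) measure" and \<Xi> and \<epsilon> :: real
    assume y: "y \<in> ginv_domain ?T" and \<epsilon>: "\<epsilon> > 0"
      and h: "(\<forall>k. \<delta> k > 0 \<and> admissible_noise ?W (M k) (\<Xi> k)) \<and> \<delta> \<longlonglongrightarrow> 0"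
    let ?E = "\<lambda>k. error_event ?T ?s unit_ell2 unit_ell2 spectral_cutoff \<alpha> y (\<delta> k) (M k) (\<Xi> k) \<epsilon>"
    have hp: "hilbert_process (M k) (\<Xi> k)" for k using h by (simp add: admissible_noise_def)
    show sets: "?E k \<in> sets (M k)" for k
      by (intro error_event_spectral_cutoff_measurable hp)
        (simp add: \<alpha>_def estimated_noise_level_measurable)
    obtain x z where yxz: "y = ?T x + z" and z: "z \<in> orthogonal_comp (range ?T)"
      using y by (auto simp: ginv_domain_def)
    have zu: "z \<bullet> unit_ell2 j = 0" for j
      using z left_singular_vector_in_range[OF bounded_linear_geometric_diagonal
          singular_system_geometric_diagonal, of j]
      unfolding orthogonal_comp_def orthogonal_def by (auto simp: inner_commute[of z] simp del: inner_unit_ell2)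
    obtain \<eta> where \<eta>: "\<eta> > 0" and conv: "\<And>\<delta> \<sigma> Y. \<lbrakk>0 < \<delta>; \<delta> < \<eta>; \<bar>\<sigma>\<bar> = 1;
        \<And>j. Y j = (1/4) ^ j * nth_ell2 x j + \<delta> * (\<sigma> * nth_ell2 rough_direction j)\<rbrakk>
      \<Longrightarrow> norm (x - regularize spectral_cutoff ?s unit_ell2 \<delta> Y) \<le> \<epsilon>"
      using cutoff_at_noise_level_converges[OF \<epsilon>] by blast
    have null: "measure (M k) (?E k) = 0" if "\<delta> k < \<eta>" for k
    proof -
      have pos: "\<delta> k > 0" and law: "process_law (M k) (\<Xi> k) = process_law coin (signed_noise rough_direction)"
        using h by (auto simp: admissible_noise_def)
      have "AE \<omega> in M k. \<omega> \<notin> ?E k"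
        using noise_coefficients_of_law[OF hp law]
      proof (rule AE_mp, intro AE_I2 impI)
        fix \<omega>
        assume "\<exists>\<sigma>. \<bar>\<sigma>\<bar> = 1 \<and> (\<forall>j. \<Xi> k (unit_ell2 j) \<omega> = \<sigma> * nth_ell2 rough_direction j)"
        then obtain \<sigma> where \<sigma>: "\<bar>\<sigma>\<bar> = 1"
          and \<Xi>: "\<And>j. \<Xi> k (unit_ell2 j) \<omega> = \<sigma> * nth_ell2 rough_direction j" by blast
        define Y where "Y = observation ?s unit_ell2 y (\<delta> k) (\<Xi> k) \<omega>"
        have Y: "Y j = (1/4) ^ j * nth_ell2 x j + \<delta> k * (\<sigma> * nth_ell2 rough_direction j)" for j
          using zu[of j] by (simp add: Y_def observation_def \<Xi> yxz del: nth_rough_direction)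
        have "norm (x - regularize spectral_cutoff ?s unit_ell2 (\<alpha> (\<delta> k) Y) Y) \<le> \<epsilon>"
          unfolding \<alpha>_def estimated_noise_level_exact[OF Y \<sigma> pos]
          by (rule conv[OF pos that \<sigma> Y])
        then show "\<omega> \<notin> ?E k"
          by (simp add: error_event_def Let_def Y_def yxz ginv_geometric_diagonal[OF z] not_less)
      qed
      then show ?thesis
        using sets[of k] by (simp add: measure_eq_0_null_sets AE_iff_null_sets)
    qed
    have "\<forall>\<^sub>F k in sequentially. \<delta> k < \<eta>"
      using h \<eta> by (intro order_tendstoD(2)) auto
    then show "(\<lambda>k. measure (M k) (?E k)) \<longlonglongrightarrow> 0"
      by (intro tendsto_eventually) (auto elim!: eventually_mono simp: null)
  qed
  moreover have "purely_data_driven \<alpha>"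
    by (simp add: purely_data_driven_def \<alpha>_def)
  ultimately show ?thesis unfolding data_driven_method_exists_def by blast
qed

section \<open>Purely data driven methods and ill-posedness\<close>

theorem theorem4p1:
  shows
    "(\<forall>(T :: 'a::{real_inner,banach,second_countable_topology} \<Rightarrow>
             'b::{real_inner,banach,second_countable_topology}) s v u.
        hilbert_schmidt T \<and> singular_system T s v u \<longrightarrow>
        (data_driven_method_exists T s v u centered_laws \<longleftrightarrow> closed (range T))) \<and>
     (\<exists>(T :: ell2 \<Rightarrow> ell2) s v u (M :: (ell2 \<Rightarrow> real) measure) \<Xi>.
        hilbert_schmidt T \<and> singular_system T s v u \<and> \<not> closed (range T) \<and>
        hilbert_process M \<Xi> \<and> centered M \<Xi> \<and>
        (\<exists>C. is_covariance M \<Xi> C \<and> onorm C \<le> 1) \<and>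
        data_driven_method_exists T s v u {process_law M \<Xi>})"
proof (intro conjI allI impI)
  fix T :: "'a \<Rightarrow> 'b" and s v u
  assume h: "hilbert_schmidt T \<and> singular_system T s v u"
  then have bl: "bounded_linear T" by (simp add: hilbert_schmidt_def)
  show "data_driven_method_exists T s v u centered_laws \<longleftrightarrow> closed (range T)"
    using h closed_range_iff_finite_rank[of T s v u] finite_rank_of_data_driven_method[of T s v u]
      data_driven_method_of_finite_rank[OF bl, of s v u] by blast
next
  let ?T = geometric_diagonal and ?s = "\<lambda>j. (1/4 :: real) ^ j" and ?w = rough_direction
  let ?L = "process_law coin (signed_noise ?w)" and ?X = "\<lambda>v (p :: ell2 \<Rightarrow> real). p v"
  let ?C = "\<lambda>v. (?w \<bullet> v) *\<^sub>R ?w"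
  note hp = hilbert_process_signed_noise[of ?w]
  have "infinite {j. ?s j > 0}" by simp
  then have "\<not> closed (range ?T)"
    using closed_range_iff_finite_rank[OF hilbert_schmidt_geometric_diagonal
        singular_system_geometric_diagonal] by blast
  moreover have "centered ?L ?X"
    using centered_signed_noise[of ?w] integral_process_law[OF hp coordinate_measurable]
    by (simp add: centered_def)
  moreover have "is_covariance ?L ?X ?C \<and> onorm ?C \<le> 1"
    using is_covariance_coordinate[OF hp is_covariance_signed_noise]
      onorm_covariance_signed_noise[OF norm_rough_direction] by blast
  moreover have "data_driven_method_exists ?T ?s unit_ell2 unit_ell2 {process_law ?L ?X}"
    unfolding process_law_coordinate by (rule data_driven_method_for_rough_noise)
  ultimately show "\<exists>(T :: ell2 \<Rightarrow> ell2) s v u (M :: (ell2 \<Rightarrow> real) measure) \<Xi>.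
        hilbert_schmidt T \<and> singular_system T s v u \<and> \<not> closed (range T) \<and>
        hilbert_process M \<Xi> \<and> centered M \<Xi> \<and>
        (\<exists>C. is_covariance M \<Xi> C \<and> onorm C \<le> 1) \<and>
        data_driven_method_exists T s v u {process_law M \<Xi>}"
    using hilbert_schmidt_geometric_diagonal singular_system_geometric_diagonal
      hilbert_process_coordinate[OF hp] by blast
qed

end
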